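(* Let $\phi$ be an irreducible codimension one Anosov action of $\mathbb{R}^k$ on a closed connected manifold $M$. Then all the non-compact orbits of $\phi$ are planes, i.e. diffeomorphic to $\mathbb{R}^k$.
   Context: Closed means compact without boundary. Let $\phi$ be a $C^{1+}$ action of $\mathbb{R}^k$ on $M$ ($C^1$ with Hölder continuous derivatives) which is locally free (isotropy groups are discrete); write $\phi^v=\phi(v,\cdot)$, and let $T\phi\subset TM$ be the subbundle tangent to the orbits. Each orbit is given the manifold structure of the quotient of $\mathbb{R}^k$ by the isotropy group. Fix a Riemannian metric on $M$. An element $a\in\mathbb{R}^k$ is an Anosov element for $\phi$ if, for $g=\phi^a$, there are real numbers $\lambda>0$, $C>0$ and a continuous $Dg$-invariant splitting $TM=E_a^{ss}\oplus T\phi\oplus E_a^{uu}$ with $\|Dg^n|_{E_a^{ss}}\|\le Ce^{-\lambda n}$ for all $n>0$ and $\|Dg^n|_{E_a^{uu}}\|\le Ce^{\lambda n}$ for all $n<0$. The action is Anosov if it has an Anosov element, and a codimension one Anosov action if $E_a^{uu}$ is one-dimensional for some Anosov element $a$; such an $a$ is fixed. The bundle $T\phi\oplus E_a^{ss}$ is integrable; the tangent foliation $\mathcal{F}^{s}$ (weak stable) has codimension one. A codimension one Anosov action $\phi$ is irreducible if for any $v\in\mathbb{R}^k\setminus\{0\}$ and $x\in M$ with $\phi^v(x)=x$, the holonomy of $\mathcal{F}^s$ along the loop $\gamma=\{\phi^{sv}(x): s\in[0,1]\}$ in the leaf $\mathcal{F}^s(x)$ (a germ at $x$ of homeomorphism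 of a one-dimensional transversal fixing $x$) is a topological contraction or a topological expansion. *)

theory Defs
  imports "HOL-Analysis.Analysis"
begin

section \<open>Smooth manifolds\<close>

primrec Cn_on :: "nat \<Rightarrow> 'a::real_normed_vector set \<Rightarrow> ('a \<Rightarrow> 'b::real_normed_vector) \<Rightarrow> bool" where
  "Cn_on 0 S f \<longleftrightarrow> continuous_on S f"
| "Cn_on (Suc n) S f \<longleftrightarrow>
     (\<forall>x\<in>S. f differentiable (at x)) \<and> (\<forall>v. Cn_on n S (\<lambda>x. frechet_derivative f (at x) v))"

text \<open>Only used for open \<open>S\<close>.\<close>
definition smooth_on :: "'a::real_normed_vector set \<Rightarrow> ('a \<Rightarrow> 'b::real_normed_vector) \<Rightarrow> bool" where
  "smooth_on S f \<longleftrightarrow> (\<forall>n. Cn_on n S f)"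

text \<open>A chart is a pair of its domain and the coordinate map; the values of the coordinate
  map outside the domain are irrelevant.\<close>
type_synonym ('p, 'e) chart = "'p set \<times> ('p \<Rightarrow> 'e)"

definition chart_inv :: "('p, 'e) chart \<Rightarrow> 'e \<Rightarrow> 'p" where
  "chart_inv c = inv_into (fst c) (snd c)"

text \<open>The space and its topology are given by an abstract topology, since below both the ambient
  manifold (with the topology of its type) and its orbits (with a topology that is in general
  finer than the subspace topology) are treated as manifolds.\<close>
definition smooth_manifold :: "'p topology \<Rightarrow> ('p, 'e::euclidean_space) chart set \<Rightarrow> bool" where
  "smooth_manifold X A \<longleftrightarrow>
     Hausdorff_space X \<and> second_countable X \<and>
     (\<Union>c\<in>A. fst c) = topspace X \<and>
     (\<forall>c\<in>A. openin X (fst c) \<and> open (snd c ` fst c) \<and>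
        homeomorphic_map (subtopology X (fst c)) (top_of_set (snd c ` fst c)) (snd c)) \<and>
     (\<forall>c\<in>A. \<forall>d\<in>A. smooth_on (snd c ` (fst c \<inter> fst d)) (snd d \<circ> chart_inv c))"

definition smooth_map ::
  "'p topology \<Rightarrow> ('p, 'e::euclidean_space) chart set \<Rightarrow>
   'q topology \<Rightarrow> ('q, 'f::euclidean_space) chart set \<Rightarrow> ('p \<Rightarrow> 'q) \<Rightarrow> bool" where
  "smooth_map X A Y B h \<longleftrightarrow>
     continuous_map X Y h \<and>
     (\<forall>c\<in>A. \<forall>d\<in>B. smooth_on (snd c ` {p \<in> fst c. h p \<in> fst d}) (snd d \<circ> h \<circ> chart_inv c))"

definition diffeomorphic ::
  "'p topology \<Rightarrow> ('p, 'e::euclidean_space) chart set \<Rightarrow>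
   'q topology \<Rightarrow> ('q, 'f::euclidean_space) chart set \<Rightarrow> bool" where
  "diffeomorphic X A Y B \<longleftrightarrow>
     (\<exists>h k. smooth_map X A Y B h \<and> smooth_map Y B X A k \<and>
        (\<forall>p\<in>topspace X. k (h p) = p) \<and> (\<forall>q\<in>topspace Y. h (k q) = q))"

definition standard_atlas :: "('e::euclidean_space, 'e) chart set" where
  "standard_atlas = {(UNIV, id)}"


section \<open>Tangent objects in coordinates\<close>

text \<open>The derivative at \<open>p\<close> of a self-map \<open>h\<close> of the manifold, read in the chart \<open>c\<close> at \<open>p\<close> and
  the chart \<open>d\<close> at \<open>h p\<close>. For \<open>h = id\<close> this is the change of coordinates of tangent vectors at \<open>p\<close>
  from \<open>c\<close> to \<open>d\<close>.\<close>
definition chart_deriv ::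
  "('p, 'e::euclidean_space) chart \<Rightarrow> ('p, 'e) chart \<Rightarrow> ('p \<Rightarrow> 'p) \<Rightarrow> 'p \<Rightarrow> 'e \<Rightarrow> 'e" where
  "chart_deriv c d h p = frechet_derivative (snd d \<circ> h \<circ> chart_inv c) (at (snd c p))"

text \<open>A field of tangent subspaces \<open>E\<close> is given by its coordinate expressions: \<open>E c p\<close> is the
  subspace of the tangent space at \<open>p\<close>, seen in the chart \<open>c\<close>, and only matters for \<open>c \<in> A\<close> and
  \<open>p \<in> fst c\<close>.  The expressions in different charts are linked by the transformation law of
  tangent vectors.\<close>
type_synonym ('p, 'e) plane_field = "('p, 'e) chart \<Rightarrow> 'p \<Rightarrow> 'e set"

text \<open>Continuity of a subbundle is the existence of local continuous frames.\<close>
definition continuous_subbundle ::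
  "('p::topological_space, 'e::euclidean_space) chart set \<Rightarrow> ('p, 'e) plane_field \<Rightarrow> bool" where
  "continuous_subbundle A E \<longleftrightarrow>
     (\<forall>c\<in>A. \<forall>d\<in>A. \<forall>p\<in>fst c \<inter> fst d. E d p = chart_deriv c d id p ` E c p) \<and>
     (\<forall>c\<in>A. \<forall>p\<in>fst c. \<exists>N (r::nat) (b::nat \<Rightarrow> 'p \<Rightarrow> 'e).
        open N \<and> p \<in> N \<and> N \<subseteq> fst c \<and>
        (\<forall>i<r. continuous_on N (b i)) \<and>
        (\<forall>q\<in>N. inj_on (\<lambda>i. b i q) {..<r} \<and> independent ((\<lambda>i. b i q) ` {..<r}) \<and>
           span ((\<lambda>i. b i q) ` {..<r}) = E c q))"

definition riemannian_metric ::
  "('p, 'e::euclidean_space) chart set \<Rightarrow> (('p, 'e) chart \<Rightarrow> 'p \<Rightarrow> 'e \<Rightarrow> 'e \<Rightarrow> real) \<Rightarrow> bool" where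
  "riemannian_metric A G \<longleftrightarrow>
     (\<forall>c\<in>A. \<forall>p\<in>fst c. bilinear (G c p) \<and> (\<forall>u w. G c p u w = G c p w u) \<and>
        (\<forall>w. w \<noteq> 0 \<longrightarrow> G c p w w > 0)) \<and>
     (\<forall>c\<in>A. \<forall>d\<in>A. \<forall>p\<in>fst c \<inter> fst d. \<forall>u w.
        G c p u w = G d p (chart_deriv c d id p u) (chart_deriv c d id p w)) \<and>
     (\<forall>c\<in>A. \<forall>u w. smooth_on (snd c ` fst c) (\<lambda>y. G c (chart_inv c y) u w))"

definition tangent_norm ::
  "(('p, 'e::euclidean_space) chart \<Rightarrow> 'p \<Rightarrow> 'e \<Rightarrow> 'e \<Rightarrow> real) \<Rightarrow> ('p, 'e) chart \<Rightarrow> 'p \<Rightarrow> 'e \<Rightarrow> real"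
  where "tangent_norm G c p w = sqrt (G c p w w)"


section \<open>Actions of \<open>\<real>\<^sup>k\<close>\<close>

text \<open>Actions of class \<open>C\<^sup>1\<close> with locally Hoelder continuous derivatives, for some exponent
  \<open>\<alpha>\<close>. Differentiability is joint in the group element and the point; Hoelder continuity includes
  continuity of the derivative.\<close>
definition C1plus_action ::
  "('p::topological_space, 'e::euclidean_space) chart set \<Rightarrow> (real^'k \<Rightarrow> 'p \<Rightarrow> 'p) \<Rightarrow> bool" where
  "C1plus_action A \<phi> \<longleftrightarrow>
     (\<forall>p. \<phi> 0 p = p) \<and> (\<forall>u v p. \<phi> (u + v) p = \<phi> u (\<phi> v p)) \<and>
     continuous_on UNIV (\<lambda>(v, p). \<phi> v p) \<and>
     (\<exists>\<alpha>>0. \<alpha> \<le> 1 \<and>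
       (\<forall>c\<in>A. \<forall>d\<in>A.
          let S = {(v, y). y \<in> snd c ` fst c \<and> \<phi> v (chart_inv c y) \<in> fst d};
              \<Phi> = (\<lambda>(v, y). snd d (\<phi> v (chart_inv c y)))
          in \<forall>z\<in>S. \<Phi> differentiable (at z) \<and>
               (\<exists>\<epsilon>>0. \<exists>K. \<forall>z1 \<in> S \<inter> ball z \<epsilon>. \<forall>z2 \<in> S \<inter> ball z \<epsilon>.
                  onorm (\<lambda>w. frechet_derivative \<Phi> (at z1) w - frechet_derivative \<Phi> (at z2) w)
                    \<le> K * norm (z1 - z2) powr \<alpha>)))"

definition isotropy :: "(real^'k \<Rightarrow> 'p \<Rightarrow> 'p) \<Rightarrow> 'p \<Rightarrow> (real^'k) set" where
  "isotropy \<phi> p = {v. \<phi> v p = p}"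

definition locally_free :: "(real^'k \<Rightarrow> 'p \<Rightarrow> 'p) \<Rightarrow> bool" where
  "locally_free \<phi> \<longleftrightarrow> (\<forall>p. discrete (isotropy \<phi> p))"

definition orbit :: "(real^'k \<Rightarrow> 'p \<Rightarrow> 'p) \<Rightarrow> 'p \<Rightarrow> 'p set" where
  "orbit \<phi> p = range (\<lambda>v. \<phi> v p)"

text \<open>The manifold structure of the quotient of \<open>\<real>\<^sup>k\<close> by the isotropy group, transported to the
  orbit along the bijection induced by \<open>v \<mapsto> \<phi> v p\<close>: the quotient topology, and as charts the local
  inverses of the orbit map.\<close>
definition orbit_topology :: "(real^'k \<Rightarrow> 'p \<Rightarrow> 'p) \<Rightarrow> 'p \<Rightarrow> 'p topology" where
  "orbit_topology \<phi> p = topology (\<lambda>U. U \<subseteq> orbit \<phi> p \<and> open {v. \<phi> v p \<in> U})"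

definition orbit_atlas :: "(real^'k \<Rightarrow> 'p \<Rightarrow> 'p) \<Rightarrow> 'p \<Rightarrow> ('p, real^'k) chart set" where
  "orbit_atlas \<phi> p =
     {((\<lambda>v. \<phi> v p) ` U, inv_into U (\<lambda>v. \<phi> v p)) | U. open U \<and> inj_on (\<lambda>v. \<phi> v p) U}"

lemma openin_orbit_topology:
  "openin (orbit_topology \<phi> p) U \<longleftrightarrow> U \<subseteq> orbit \<phi> p \<and> open {v. \<phi> v p \<in> U}"
proof -
  have "istopology (\<lambda>U. U \<subseteq> orbit \<phi> p \<and> open {v. \<phi> v p \<in> U})"
  proof -
    have "open {v. \<phi> v p \<in> S \<inter> T}" if "open {v. \<phi> v p \<in> S}" "open {v. \<phi> v p \<in> T}" for S T
      using open_Int[OF that] by (simp add: Collect_conj_eq)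
    moreover have "open {v. \<phi> v p \<in> \<Union>K}" if "\<forall>S\<in>K. open {v. \<phi> v p \<in> S}" for K
    proof -
      have "{v. \<phi> v p \<in> \<Union>K} = (\<Union>S\<in>K. {v. \<phi> v p \<in> S})" by blast
      with that show ?thesis by auto
    qed
    ultimately show ?thesis
      unfolding istopology_def by blast
  qed
  then show ?thesis
    by (simp add: orbit_topology_def)
qed

lemma topspace_orbit_topology: "topspace (orbit_topology \<phi> p) = orbit \<phi> p"
proof -
  have "openin (orbit_topology \<phi> p) (orbit \<phi> p)"
    by (simp add: openin_orbit_topology orbit_def)
  then show ?thesis
    by (meson openin_orbit_topology openin_subset openin_topspace subset_antisym)
qed

lemma quotient_map_orbit: "quotient_map euclidean (orbit_topology \<phi> p) (\<lambda>v. \<phi> v p)"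
  unfolding quotient_map_def
  by (auto simp: topspace_orbit_topology openin_orbit_topology orbit_def)

definition orbit_tangent :: "(real^'k \<Rightarrow> 'p \<Rightarrow> 'p) \<Rightarrow> ('p, 'e::euclidean_space) plane_field" where
  "orbit_tangent \<phi> c p = range (frechet_derivative (\<lambda>v. snd c (\<phi> v p)) (at 0))"


section \<open>Anosov elements\<close>

definition invariant_field ::
  "('p, 'e::euclidean_space) chart set \<Rightarrow> ('p \<Rightarrow> 'p) \<Rightarrow> ('p, 'e) plane_field \<Rightarrow> bool" where
  "invariant_field A g E \<longleftrightarrow>
     (\<forall>c\<in>A. \<forall>d\<in>A. \<forall>p\<in>fst c. g p \<in> fst d \<longrightarrow> chart_deriv c d g p ` E c p = E d (g p))"

text \<open>\<open>a\<close> is an Anosov element, with stable bundle \<open>Ess\<close> and unstable bundle \<open>Euu\<close>. The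
  \<open>n\<close>-th iterate of \<open>\<phi> a\<close> is \<open>\<phi> (n a)\<close>, for every integer \<open>n\<close>.\<close>
definition anosov_splitting ::
  "('p::topological_space, 'e::euclidean_space) chart set \<Rightarrow>
   (('p, 'e) chart \<Rightarrow> 'p \<Rightarrow> 'e \<Rightarrow> 'e \<Rightarrow> real) \<Rightarrow> (real^'k \<Rightarrow> 'p \<Rightarrow> 'p) \<Rightarrow> real^'k \<Rightarrow>
   ('p, 'e) plane_field \<Rightarrow> ('p, 'e) plane_field \<Rightarrow> bool" where
  "anosov_splitting A G \<phi> a Ess Euu \<longleftrightarrow>
     continuous_subbundle A Ess \<and> continuous_subbundle A Euu \<and>
     invariant_field A (\<phi> a) Ess \<and> invariant_field A (\<phi> a) Euu \<and>
     (\<forall>c\<in>A. \<forall>p\<in>fst c.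
        (\<forall>w. \<exists>x\<in>Ess c p. \<exists>y\<in>orbit_tangent \<phi> c p. \<exists>z\<in>Euu c p. w = x + y + z) \<and>
        (\<forall>x\<in>Ess c p. \<forall>y\<in>orbit_tangent \<phi> c p. \<forall>z\<in>Euu c p.
           x + y + z = 0 \<longrightarrow> x = 0 \<and> y = 0 \<and> z = 0)) \<and>
     (\<exists>l>0. \<exists>C>0. \<forall>n::int. \<forall>c\<in>A. \<forall>d\<in>A. \<forall>p\<in>fst c.
        \<phi> (of_int n *\<^sub>R a) p \<in> fst d \<longrightarrow>
        (n > 0 \<longrightarrow> (\<forall>w\<in>Ess c p.
           tangent_norm G d (\<phi> (of_int n *\<^sub>R a) p) (chart_deriv c d (\<phi> (of_int n *\<^sub>R a)) p w)
             \<le> C * exp (- l * of_int n) * tangent_norm G c p w)) \<and>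
        (n < 0 \<longrightarrow> (\<forall>w\<in>Euu c p.
           tangent_norm G d (\<phi> (of_int n *\<^sub>R a) p) (chart_deriv c d (\<phi> (of_int n *\<^sub>R a)) p w)
             \<le> C * exp (l * of_int n) * tangent_norm G c p w)))"

definition codim_one_splitting ::
  "('p::topological_space, 'e::euclidean_space) chart set \<Rightarrow>
   (('p, 'e) chart \<Rightarrow> 'p \<Rightarrow> 'e \<Rightarrow> 'e \<Rightarrow> real) \<Rightarrow> (real^'k \<Rightarrow> 'p \<Rightarrow> 'p) \<Rightarrow> real^'k \<Rightarrow>
   ('p, 'e) plane_field \<Rightarrow> ('p, 'e) plane_field \<Rightarrow> bool" where
  "codim_one_splitting A G \<phi> a Ess Euu \<longleftrightarrow>
     anosov_splitting A G \<phi> a Ess Euu \<and> (\<forall>c\<in>A. \<forall>p\<in>fst c. dim (Euu c p) = 1)"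

definition weak_stable_field ::
  "(real^'k \<Rightarrow> 'p \<Rightarrow> 'p) \<Rightarrow> ('p, 'e::euclidean_space) plane_field \<Rightarrow> ('p, 'e) plane_field" where
  "weak_stable_field \<phi> Ess c p = {y + x | y x. y \<in> orbit_tangent \<phi> c p \<and> x \<in> Ess c p}"


section \<open>Codimension one foliations and holonomy\<close>

text \<open>A foliated chart \<open>c\<close> is a homeomorphism of its domain onto a product \<open>P \<times> I\<close>; its plaques are
  the levels of the transverse coordinate. \<open>'b\<close> is the model space of the leaves.\<close>
type_synonym ('p, 'b) foliated_chart = "('p, 'b \<times> real) chart"

abbreviation transverse :: "('p, 'b) foliated_chart \<Rightarrow> 'p \<Rightarrow> real" where
  "transverse c p \<equiv> snd (snd c p)"

definition foliation_atlas ::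
  "('p::topological_space, 'b::euclidean_space) foliated_chart set \<Rightarrow> bool" where
  "foliation_atlas F \<longleftrightarrow>
     (\<Union>c\<in>F. fst c) = UNIV \<and>
     (\<forall>c\<in>F. open (fst c) \<and> (\<exists>P I. open P \<and> connected P \<and> open I \<and> connected I \<and>
        homeomorphism (fst c) (P \<times> I) (snd c) (chart_inv c))) \<and>
     (\<forall>c\<in>F. \<forall>d\<in>F. \<forall>p\<in>fst c \<inter> fst d. \<exists>N \<beta>. open N \<and> p \<in> N \<and> N \<subseteq> fst c \<inter> fst d \<and>
        (\<forall>q\<in>N. transverse d q = \<beta> (transverse c q)))"

text \<open>Along its plaques, a foliated chart parametrises \<open>C\<^sup>1\<close> immersed submanifolds tangent to \<open>E\<close>,
  with derivatives \<open>D\<close> depending continuously on the point. No differentiability across the plaques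
  is required.\<close>
definition tangent_foliation ::
  "('p::topological_space, 'e::euclidean_space) chart set \<Rightarrow> ('p, 'e) plane_field \<Rightarrow>
   ('p, 'b::euclidean_space) foliated_chart set \<Rightarrow> bool" where
  "tangent_foliation A E F \<longleftrightarrow> foliation_atlas F \<and>
     (\<forall>f\<in>F. \<forall>c\<in>A. \<exists>D :: 'p \<Rightarrow> 'b \<Rightarrow> 'e.
        (\<forall>h. continuous_on (fst f \<inter> fst c) (\<lambda>p. D p h)) \<and>
        (\<forall>p \<in> fst f \<inter> fst c.
           ((\<lambda>u. snd c (chart_inv f (u, transverse f p))) has_derivative D p) (at (fst (snd f p))) \<and>
           inj (D p) \<and> range (D p) = E c p))"

text \<open>Holonomy of the path \<open>\<gamma>\<close>, which has to stay in a leaf, by continuation along a chain of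
  plaques.  \<open>holonomy F \<gamma> c0 c s h\<close> says: sliding along the plaques met by \<open>\<gamma>\<close> up to time \<open>s\<close> takes a
  local transversal at \<open>\<gamma> 0\<close>, parametrised by the transverse coordinate of \<open>c0\<close>, to a local transversal
  at \<open>\<gamma> s\<close>, parametrised by the transverse coordinate of \<open>c\<close>, and in these coordinates this is the
  germ of \<open>h\<close> at \<open>transverse c0 (\<gamma> 0)\<close>. Only the germ of \<open>h\<close> is meaningful.\<close>
inductive holonomy ::
  "('p::topological_space, 'b::euclidean_space) foliated_chart set \<Rightarrow> (real \<Rightarrow> 'p) \<Rightarrow>
   ('p, 'b) foliated_chart \<Rightarrow> ('p, 'b) foliated_chart \<Rightarrow> real \<Rightarrow> (real \<Rightarrow> real) \<Rightarrow> bool"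
  for F \<gamma> c0 where
  start: "c0 \<in> F \<Longrightarrow> \<gamma> 0 \<in> fst c0 \<Longrightarrow> holonomy F \<gamma> c0 c0 0 id"
| slide: "holonomy F \<gamma> c0 c s h \<Longrightarrow> s \<le> s' \<Longrightarrow>
    (\<And>r. r \<in> {s..s'} \<Longrightarrow> \<gamma> r \<in> fst c \<and> transverse c (\<gamma> r) = transverse c (\<gamma> s)) \<Longrightarrow>
    holonomy F \<gamma> c0 c s' h"
| change: "holonomy F \<gamma> c0 c s h \<Longrightarrow> d \<in> F \<Longrightarrow>
    open N \<Longrightarrow> \<gamma> s \<in> N \<Longrightarrow> N \<subseteq> fst c \<inter> fst d \<Longrightarrow>
    (\<And>q. q \<in> N \<Longrightarrow> transverse d q = \<beta> (transverse c q)) \<Longrightarrow>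
    holonomy F \<gamma> c0 d s (\<beta> \<circ> h)"

text \<open>Neighbourhoods of arbitrarily small size are required so that the notion depends only on the
  germ of \<open>h\<close> at \<open>t\<close>.\<close>
definition topological_contraction :: "(real \<Rightarrow> real) \<Rightarrow> real \<Rightarrow> bool" where
  "topological_contraction h t \<longleftrightarrow> h t = t \<and>
     (\<forall>V. open V \<and> t \<in> V \<longrightarrow>
        (\<exists>U. open U \<and> t \<in> U \<and> U \<subseteq> V \<and> h ` U \<subseteq> U \<and>
           (\<forall>y\<in>U. (\<lambda>n. (h ^^ n) y) \<longlonglongrightarrow> t)))"

text \<open>\<open>k\<close> represents the inverse germ of \<open>h\<close>.\<close>
definition topological_expansion :: "(real \<Rightarrow> real) \<Rightarrow> real \<Rightarrow> bool" where
  "topological_expansion h t \<longleftrightarrow>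
     (\<exists>k. (\<forall>\<^sub>F y in nhds t. k (h y) = y) \<and> (\<forall>\<^sub>F y in nhds t. h (k y) = y) \<and>
        topological_contraction k t)"

text \<open>\<open>F\<close> is the weak stable foliation. The loop lies in a leaf of \<open>F\<close>, so its holonomy exists, and
  its germ is uniquely determined by the initial (and final) foliated chart \<open>c\<close>.\<close>
definition irreducible_action ::
  "('p::topological_space, 'b::euclidean_space) foliated_chart set \<Rightarrow>
   (real^'k \<Rightarrow> 'p \<Rightarrow> 'p) \<Rightarrow> bool" where
  "irreducible_action F \<phi> \<longleftrightarrow>
     (\<forall>v x. v \<noteq> 0 \<and> \<phi> v x = x \<longrightarrow>
        (\<forall>c\<in>F. x \<in> fst c \<longrightarrow>
           (\<exists>h. holonomy F (\<lambda>s. \<phi> (s *\<^sub>R v) x) c c 1 h \<and>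
              (topological_contraction h (transverse c x) \<or>
               topological_expansion h (transverse c x)))))"

end

theory Submission
  imports Defs
begin

text \<open>Let \<open>v \<noteq> 0\<close> fix a point and let \<open>Q\<close> be the closed, \<open>\<phi>\<close>-invariant set of all fixed points of
  \<open>\<phi> v\<close>. If \<open>z \<in> Q\<close> is close to \<open>y \<in> Q\<close>, the holonomy along the loop of \<open>y\<close> fixes the transverse
  coordinate of \<open>z\<close>; being a contraction or an expansion it fixes only that of \<open>y\<close>, so \<open>z\<close> lies in
  the plaque of \<open>y\<close>. Hence finitely many plaques, around points \<open>y i\<close>, cover \<open>Q\<close>.

  A point \<open>z\<close> of a small plaque of \<open>y\<close> is joined to it by a curve with velocity in
  \<open>T\<phi> \<oplus> E\<^sup>s\<^sup>s\<close>. Integrating the \<open>T\<phi>\<close>-component gives a bounded \<open>b\<close> such that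
  \<open>\<phi> (n a - b) z\<close> and \<open>\<phi> (n a) y\<close> are asymptotic as \<open>n\<close> grows, uniformly in \<open>z\<close>. Since \<open>Q = \<phi> (n a) Q\<close>
  for all \<open>n\<close>, in the limit \<open>Q\<close> is covered by finitely many sets \<open>{\<phi> b (y' i) | norm b \<le> R}\<close>, where
  \<open>y' i\<close> is a limit of \<open>\<phi> (n a) (y i)\<close>. So every orbit in \<open>Q\<close> is a finite union of compact pieces.
  A non-compact orbit therefore has trivial isotropy.\<close>

section \<open>Continuous families of linear maps\<close>

text \<open>Asymptotic behaviour is measured on curves rather than with stable manifolds or a
  distance function: a curve in a plaque is carried by the flow and its Riemannian speed is
  followed. The orbit component of its velocity is not contracted, so it has to be removed. This
  costs only a bounded factor: \<open>\<phi> (n a - U t)\<close> is \<open>\<phi> (n a)\<close>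
  followed by \<open>\<phi> (- U t)\<close>, and \<open>norm (U t)\<close> is bounded independently
  of \<open>n\<close> and of the end point. For the limit, a point \<open>z\<close> of
  \<open>Q\<close> is written as the image under \<open>\<phi> (n a)\<close> of a point that is
  again in \<open>Q\<close>, hence again in one of the finitely many plaques. Plaque and
  \<open>b\<close> change with \<open>n\<close>, but the indices are finitely many and the
  \<open>b\<close> lie in a ball, so both settle along a finer filter. There the error vanishes, and
  \<open>z\<close>, which does not depend on \<open>n\<close>, equals the limit exactly. Limits are
  taken along filters because \<open>'m\<close> is a mere topological space whose Hausdorff property
  comes from the manifold hypothesis. Compactness of an orbit is meant in the quotient topology, in
  general finer than the subspace topology; this is why the final pieces are parametrised by balls
  of the acting group.\<close>

lemma continuous_on_open_tendsto_nhds: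
  assumes "continuous_on N f" "open N" "z \<in> N"
  shows "(f \<longlongrightarrow> f z) (nhds z)"
  using assms by (metis at_within_open continuous_on_def tendsto_at_iff_tendsto_nhds)

text \<open>In finite dimension the values on the basis vectors control the operator norm, with the
  factor \<open>DIM('c)\<close> lost in \<open>\<delta>\<close>. Continuity can therefore be assumed
  one vector at a time, the form in which it is known for derivatives, frames and metrics
  below.\<close>

lemma linear_family_close:
  fixes L :: "'a::topological_space \<Rightarrow> 'c::euclidean_space \<Rightarrow> 'd::real_normed_vector"
  assumes N: "open N" "z0 \<in> N"
    and lin: "\<And>z. z \<in> N \<Longrightarrow> linear (L z)"
    and cont: "\<And>w. continuous_on N (\<lambda>z. L z w)"
    and "\<epsilon> > 0"
  obtains N' where "open N'" "z0 \<in> N'" "N' \<subseteq> N"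
    "\<And>z w. z \<in> N' \<Longrightarrow> norm (L z w - L z0 w) \<le> \<epsilon> * norm w"
proof -
  define \<delta> where "\<delta> = \<epsilon> / real DIM('c)"
  have "\<delta> > 0" using \<open>\<epsilon> > 0\<close> by (simp add: \<delta>_def)
  have "\<forall>\<^sub>F z in nhds z0. dist (L z i) (L z0 i) < \<delta>" for i
  proof -
    have "((\<lambda>z. L z i) \<longlongrightarrow> L z0 i) (nhds z0)"
      using cont N by (rule continuous_on_open_tendsto_nhds)
    then show ?thesis
      using \<open>\<delta> > 0\<close> by (rule tendstoD)
  qed
  then have "\<forall>\<^sub>F z in nhds z0. \<forall>i\<in>Basis. dist (L z i) (L z0 i) < \<delta>"
    by (simp add: eventually_ball_finite)
  then obtain N1 where N1: "open N1" "z0 \<in> N1" "\<And>z i. z \<in> N1 \<Longrightarrow> i \<in> Basis \<Longrightarrow> dist (L z i) (L z0 i) < \<delta>"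
    unfolding eventually_nhds by blast
  show thesis
  proof
    show "open (N \<inter> N1)" "z0 \<in> N \<inter> N1" "N \<inter> N1 \<subseteq> N" using N N1 by auto
    fix z and w :: 'c assume z: "z \<in> N \<inter> N1"
    interpret l: linear "\<lambda>w. L z w - L z0 w"
      using lin[of z] lin[of z0] z N by (intro linear_compose_sub) auto
    have "L z (\<Sum>i\<in>Basis. (w \<bullet> i) *\<^sub>R i) - L z0 (\<Sum>i\<in>Basis. (w \<bullet> i) *\<^sub>R i)
        = (\<Sum>i\<in>Basis. (w \<bullet> i) *\<^sub>R (L z i - L z0 i))"
      unfolding l.sum l.scaleR ..
    then have "norm (L z w - L z0 w) = norm (\<Sum>i\<in>Basis. (w \<bullet> i) *\<^sub>R (L z i - L z0 i))"
      by (simp only: euclidean_representation)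
    also have "\<dots> \<le> (\<Sum>i\<in>(Basis::'c set). norm w * \<delta>)"
    proof (rule sum_norm_le)
      fix i :: 'c assume i: "i \<in> Basis"
      then have "norm (L z i - L z0 i) \<le> \<delta>"
        using N1(3)[of z i] z by (simp add: dist_norm)
      then show "norm ((w \<bullet> i) *\<^sub>R (L z i - L z0 i)) \<le> norm w * \<delta>"
        using Basis_le_norm[OF i, of w] by (auto intro: mult_mono)
    qed
    also have "\<dots> = \<epsilon> * norm w" by (simp add: \<delta>_def)
    finally show "norm (L z w - L z0 w) \<le> \<epsilon> * norm w" .
  qed
qed

lemma linear_family_bounded_above:
  fixes L :: "'a::topological_space \<Rightarrow> 'c::euclidean_space \<Rightarrow> 'd::real_normed_vector"
  assumes N: "open N" "z0 \<in> N"
    and lin: "\<And>z. z \<in> N \<Longrightarrow> linear (L z)"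
    and cont: "\<And>w. continuous_on N (\<lambda>z. L z w)"
  obtains N' M where "open N'" "z0 \<in> N'" "N' \<subseteq> N" "M > 0"
    "\<And>z w. z \<in> N' \<Longrightarrow> norm (L z w) \<le> M * norm w"
proof -
  obtain N' where N': "open N'" "z0 \<in> N'" "N' \<subseteq> N"
    "\<And>z w. z \<in> N' \<Longrightarrow> norm (L z w - L z0 w) \<le> 1 * norm w"
    using linear_family_close[OF N lin cont zero_less_one] by blast
  obtain B where B: "B > 0" "\<And>w. norm (L z0 w) \<le> B * norm w"
    using linear_bounded_pos[OF lin[OF N(2)]] by blast
  show thesis
  proof
    show "open N'" "z0 \<in> N'" "N' \<subseteq> N" "B + 1 > 0" using N' B by auto
    fix z w assume "z \<in> N'"
    have "norm (L z w) \<le> norm (L z w - L z0 w) + norm (L z0 w)"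
      using norm_triangle_ineq[of "L z w - L z0 w" "L z0 w"] by simp
    also have "\<dots> \<le> (B + 1) * norm w"
      using N'(4)[OF \<open>z \<in> N'\<close>, of w] B(2)[of w] by (simp add: algebra_simps)
    finally show "norm (L z w) \<le> (B + 1) * norm w" .
  qed
qed

text \<open>Injectivity of \<open>L z0\<close> on the fixed subspace \<open>W\<close> gives a lower
  bound \<open>e\<close> there; a perturbation of size \<open>e/2\<close> leaves half of it.\<close>

lemma linear_family_bounded_below:
  fixes L :: "'a::topological_space \<Rightarrow> 'c::euclidean_space \<Rightarrow> 'd::euclidean_space"
  assumes N: "open N" "z0 \<in> N"
    and lin: "\<And>z. z \<in> N \<Longrightarrow> linear (L z)"
    and cont: "\<And>w. continuous_on N (\<lambda>z. L z w)"
    and W: "subspace W" "\<And>w. w \<in> W \<Longrightarrow> L z0 w = 0 \<Longrightarrow> w = 0"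
  obtains N' e where "open N'" "z0 \<in> N'" "N' \<subseteq> N" "e > 0"
    "\<And>z w. z \<in> N' \<Longrightarrow> w \<in> W \<Longrightarrow> e * norm w \<le> norm (L z w)"
proof -
  obtain e where e: "e > 0" "\<And>w. w \<in> W \<Longrightarrow> e * norm w \<le> norm (L z0 w)"
    using injective_imp_isometric[of W "L z0"] W closed_subspace[OF W(1)]
      linear_conv_bounded_linear[THEN iffD1, OF lin[OF N(2)]] by blast
  obtain N' where N': "open N'" "z0 \<in> N'" "N' \<subseteq> N"
    "\<And>z w. z \<in> N' \<Longrightarrow> norm (L z w - L z0 w) \<le> (e/2) * norm w"
    using linear_family_close[OF N lin cont half_gt_zero[OF e(1)]] by blast
  show thesis
  proof
    show "open N'" "z0 \<in> N'" "N' \<subseteq> N" "e / 2 > 0" using N' e by auto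
    fix z w assume "z \<in> N'" "w \<in> W"
    have "norm (L z0 w) \<le> norm (L z w) + norm (L z w - L z0 w)"
      using norm_triangle_ineq4[of "L z w" "L z w - L z0 w"] by simp
    then show "e / 2 * norm w \<le> norm (L z w)"
      using N'(4)[OF \<open>z \<in> N'\<close>, of w] e(2)[OF \<open>w \<in> W\<close>] by (simp add: algebra_simps)
  qed
qed

text \<open>Passing to a finer nontrivial filter replaces passing to a subsequence. The indices are
  treated one at a time, each refinement preserving the limits already obtained.\<close>

lemma convergent_subfilter:
  fixes f :: "'i \<Rightarrow> 'a \<Rightarrow> 'b::topological_space"
  assumes "finite I" "compact C" "F \<noteq> bot" "\<And>i. i \<in> I \<Longrightarrow> \<forall>\<^sub>F n in F. f i n \<in> C"
  obtains F' l where "F' \<le> F" "F' \<noteq> bot" "\<And>i. i \<in> I \<Longrightarrow> (f i \<longlongrightarrow> l i) F'" "\<And>i. i \<in> I \<Longrightarrow> l i \<in> C"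
proof -
  have "\<exists>F'\<le>F. F' \<noteq> bot \<and> (\<forall>i\<in>I. \<exists>l\<in>C. (f i \<longlongrightarrow> l) F')"
    using assms(1,4)
  proof (induction I rule: finite_induct)
    case empty
    then show ?case using \<open>F \<noteq> bot\<close> by auto
  next
    case (insert i I)
    then obtain F1 where F1: "F1 \<le> F" "F1 \<noteq> bot" "\<And>i. i \<in> I \<Longrightarrow> \<exists>l\<in>C. (f i \<longlongrightarrow> l) F1"
      by auto
    have "\<forall>\<^sub>F n in F1. f i n \<in> C" using insert.prems F1(1) by (auto intro: filter_leD)
    then have "filtermap (f i) F1 \<noteq> bot" "\<forall>\<^sub>F x in filtermap (f i) F1. x \<in> C"
      using F1(2) by (auto simp: eventually_filtermap filtermap_bot_iff)
    then obtain l where l: "l \<in> C" "inf (nhds l) (filtermap (f i) F1) \<noteq> bot"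
      using \<open>compact C\<close> unfolding compact_filter by blast
    define F2 where "F2 = inf F1 (filtercomap (f i) (nhds l))"
    have "F2 \<noteq> bot"
    proof
      assume "F2 = bot"
      then obtain P Q where P: "eventually P F1" and Q: "eventually Q (filtercomap (f i) (nhds l))"
        and PQ: "\<And>x. P x \<Longrightarrow> \<not> Q x"
        unfolding F2_def trivial_limit_def eventually_inf by blast
      obtain R where R: "eventually R (nhds l)" "\<And>x. R (f i x) \<Longrightarrow> Q x"
        using Q unfolding eventually_filtercomap by blast
      have "\<forall>\<^sub>F y in filtermap (f i) F1. \<not> R y"
        unfolding eventually_filtermap using P by eventually_elim (use PQ R in blast)
      with R(1) have "eventually (\<lambda>_. False) (inf (nhds l) (filtermap (f i) F1))"
        unfolding eventually_inf by blast
      then show False using l(2) by (simp add: trivial_limit_def)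
    qed
    moreover have "(f i \<longlongrightarrow> l) F2"
      unfolding filterlim_def F2_def
      by (metis filtermap_mono filtermap_filtercomap inf.cobounded2 order_trans)
    moreover have "F2 \<le> F1" by (simp add: F2_def)
    ultimately show ?case
      using l(1) F1 by (intro exI[of _ F2]) (auto intro: tendsto_mono)
  qed
  then obtain F' where F': "F' \<le> F" "F' \<noteq> bot" "\<forall>i\<in>I. \<exists>l. l \<in> C \<and> (f i \<longlongrightarrow> l) F'"
    by blast
  then obtain l where "\<forall>i\<in>I. l i \<in> C \<and> (f i \<longlongrightarrow> l i) F'"
    by (auto dest!: bchoice)
  with F' show thesis by (intro that[of F' l]) auto
qed

lemma has_derivative_transform_nhds:
  assumes "(f has_derivative f') (at x)" "\<forall>\<^sub>F y in nhds x. f y = g y"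
  shows "(g has_derivative f') (at x)"
proof (rule has_derivative_transform_eventually[OF assms(1)])
  show "\<forall>\<^sub>F y in at x. f y = g y"
    using assms(2) by (simp add: eventually_at_filter eventually_mono)
  show "f x = g x"
    using eventually_nhds_x_imp_x[OF assms(2)] .
qed simp

section \<open>The action in charts\<close>

locale manifold_action =
  fixes A :: "('m::topological_space, 'e::euclidean_space) chart set"
    and \<phi> :: "real^'k \<Rightarrow> 'm \<Rightarrow> 'm"
  assumes manifold: "smooth_manifold (euclidean :: 'm topology) A"
    and action: "C1plus_action A \<phi>"
begin

lemma act_zero [simp]: "\<phi> 0 p = p"
  and act_add: "\<phi> (u + v) p = \<phi> u (\<phi> v p)"
  and continuous_act: "continuous_on UNIV (\<lambda>(v, p). \<phi> v p)"
  using action unfolding C1plus_action_def by blast+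

lemma act_zero_id: "\<phi> 0 = id"
  by (simp add: fun_eq_iff)

lemma act_commute: "\<phi> u (\<phi> v p) = \<phi> v (\<phi> u p)"
  by (metis act_add add.commute)

lemma tendsto_act:
  assumes "(f \<longlongrightarrow> v) F" "(g \<longlongrightarrow> p) F"
  shows "((\<lambda>x. \<phi> (f x) (g x)) \<longlongrightarrow> \<phi> v p) F"
proof -
  have "((\<lambda>x. (\<lambda>(v, p). \<phi> v p) (f x, g x)) \<longlongrightarrow> (\<lambda>(v, p). \<phi> v p) (v, p)) F"
    using continuous_on_open_tendsto_nhds[OF continuous_act open_UNIV UNIV_I] tendsto_Pair[OF assms]
    by (rule filterlim_compose)
  then show ?thesis by simp
qed

lemma continuous_on_act [continuous_intros]:
  assumes "continuous_on S f" "continuous_on S g"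
  shows "continuous_on S (\<lambda>x. \<phi> (f x) (g x))"
  using assms unfolding continuous_on_def by (blast intro: tendsto_act)

text \<open>Hausdorffness is not a type class constraint on \<open>'m\<close> but a part of
  \<open>smooth_manifold\<close>; it is extracted here for uniqueness of limits and closedness of
  compact sets.\<close>

lemma separated: "x \<noteq> y \<Longrightarrow> \<exists>U V. open U \<and> open V \<and> x \<in> U \<and> y \<in> V \<and> U \<inter> V = {}" for x y :: 'm
  using manifold unfolding smooth_manifold_def Hausdorff_space_def by (auto simp: disjnt_def)

lemma limit_unique:
  fixes l :: 'm
  assumes "F \<noteq> bot" "(f \<longlongrightarrow> l) F" "(f \<longlongrightarrow> l') F"
  shows "l = l'"
proof (rule ccontr)
  assume "l \<noteq> l'"
  then obtain U V where UV: "open U" "open V" "l \<in> U" "l' \<in> V" "U \<inter> V = {}"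
    using separated[OF \<open>l \<noteq> l'\<close>] by blast
  have "\<forall>\<^sub>F x in F. f x \<in> U" "\<forall>\<^sub>F x in F. f x \<in> V"
    using assms UV by (auto dest: topological_tendstoD)
  then have "\<forall>\<^sub>F x in F. False"
    by eventually_elim (use UV in blast)
  then show False using assms(1) by (simp add: trivial_limit_def)
qed

lemma compact_closed: "compact S \<Longrightarrow> closed S" for S :: "'m set"
  using compactin_imp_closedin[of "euclidean :: 'm topology" S] manifold
  unfolding smooth_manifold_def by simp

lemma chart_exists: obtains c where "c \<in> A" "p \<in> fst c"
proof -
  have "p \<in> (\<Union>c\<in>A. fst c)"
    using manifold unfolding smooth_manifold_def by simp
  then show thesis using that by (rule UN_E)
qed

lemma open_chart: "c \<in> A \<Longrightarrow> open (fst c)"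
  and open_chart_image: "c \<in> A \<Longrightarrow> open (snd c ` fst c)"
  using manifold unfolding smooth_manifold_def by auto

lemma chart_homeomorphism:
  assumes "c \<in> A"
  shows "homeomorphism (fst c) (snd c ` fst c) (snd c) (chart_inv c)"
proof -
  have "homeomorphic_map (subtopology euclidean (fst c)) (top_of_set (snd c ` fst c)) (snd c)"
    using assms manifold unfolding smooth_manifold_def by auto
  then obtain g where g: "homeomorphic_maps (subtopology euclidean (fst c)) (top_of_set (snd c ` fst c)) (snd c) g"
    unfolding homeomorphic_map_maps by blast
  then have g: "homeomorphism (fst c) (snd c ` fst c) (snd c) g"
    unfolding homeomorphic_maps_def homeomorphism_def by (auto simp: image_iff)
  then have "inj_on (snd c) (fst c)"
    unfolding homeomorphism_def by (metis inj_on_inverseI)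
  then have "chart_inv c y = g y" if "y \<in> snd c ` fst c" for y
    using that g unfolding chart_inv_def homeomorphism_def by (metis imageE inv_into_f_f)
  then show ?thesis
    using g by (metis (no_types, lifting) homeomorphism_cong)
qed

lemma chart_inv_chart [simp]: "c \<in> A \<Longrightarrow> p \<in> fst c \<Longrightarrow> chart_inv c (snd c p) = p"
  and chart_chart_inv: "c \<in> A \<Longrightarrow> y \<in> snd c ` fst c \<Longrightarrow> snd c (chart_inv c y) = y"
  and chart_inv_in: "c \<in> A \<Longrightarrow> y \<in> snd c ` fst c \<Longrightarrow> chart_inv c y \<in> fst c"
  and continuous_chart: "c \<in> A \<Longrightarrow> continuous_on (fst c) (snd c)"
  and continuous_chart_inv: "c \<in> A \<Longrightarrow> continuous_on (snd c ` fst c) (chart_inv c)"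
  using chart_homeomorphism unfolding homeomorphism_def by blast+

text \<open>\<open>flow_rep\<close> and \<open>flow_dom\<close> are the local \<open>\<Phi>\<close>
  and \<open>S\<close> of \<open>C1plus_action\<close>, written in the same form so that the
  regularity hypothesis folds into them.\<close>

definition flow_rep :: "('m, 'e) chart \<Rightarrow> ('m, 'e) chart \<Rightarrow> (real^'k) \<times> 'e \<Rightarrow> 'e" where
  "flow_rep c d = (\<lambda>(v, y). snd d (\<phi> v (chart_inv c y)))"

definition flow_dom :: "('m, 'e) chart \<Rightarrow> ('m, 'e) chart \<Rightarrow> ((real^'k) \<times> 'e) set" where
  "flow_dom c d = {(v, y). y \<in> snd c ` fst c \<and> \<phi> v (chart_inv c y) \<in> fst d}"

abbreviation flow_deriv where
  "flow_deriv c d z \<equiv> frechet_derivative (flow_rep c d) (at z)"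

text \<open>The infinitesimal action: the value at \<open>p\<close>, in the chart \<open>c\<close>,
  of the fundamental vector field of a group direction.\<close>

definition generator :: "('m, 'e) chart \<Rightarrow> 'm \<Rightarrow> real^'k \<Rightarrow> 'e" where
  "generator c p = frechet_derivative (\<lambda>v. snd c (\<phi> v p)) (at 0)"

lemma flow_domI: "p \<in> fst c \<Longrightarrow> c \<in> A \<Longrightarrow> \<phi> v p \<in> fst d \<Longrightarrow> (v, snd c p) \<in> flow_dom c d"
  by (auto simp: flow_dom_def)

lemma open_flow_dom:
  assumes "c \<in> A" "d \<in> A"
  shows "open (flow_dom c d)"
proof -
  have "continuous_on (UNIV \<times> snd c ` fst c) (\<lambda>z. \<phi> (fst z) (chart_inv c (snd z)))"
    by (rule continuous_on_act[OF continuous_on_fst[OF continuous_on_id]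
          continuous_on_compose2[OF continuous_chart_inv[OF assms(1)] continuous_on_snd[OF continuous_on_id]]]) auto
  then have "open ((UNIV \<times> snd c ` fst c) \<inter> (\<lambda>z. \<phi> (fst z) (chart_inv c (snd z))) -` fst d)"
    using open_chart[OF assms(2)] open_chart_image[OF assms(1)]
    by (intro continuous_open_preimage open_Times open_UNIV)
  also have "(UNIV \<times> snd c ` fst c) \<inter> (\<lambda>z. \<phi> (fst z) (chart_inv c (snd z))) -` fst d = flow_dom c d"
    by (auto simp: flow_dom_def)
  finally show ?thesis .
qed

lemma flow_rep_regular:
  assumes "c \<in> A" "d \<in> A" "z \<in> flow_dom c d"
  shows "flow_rep c d differentiable (at z)"
    and "\<exists>\<alpha>>0. \<exists>\<epsilon>>0. \<exists>K. \<forall>z1 \<in> flow_dom c d \<inter> ball z \<epsilon>. \<forall>z2 \<in> flow_dom c d \<inter> ball z \<epsilon>.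
      onorm (\<lambda>w. flow_deriv c d z1 w - flow_deriv c d z2 w) \<le> K * norm (z1 - z2) powr \<alpha>"
proof -
  obtain \<alpha> :: real where "\<alpha> > 0" and *: "\<forall>c\<in>A. \<forall>d\<in>A.
          let S = {(v, y). y \<in> snd c ` fst c \<and> \<phi> v (chart_inv c y) \<in> fst d};
              \<Phi> = (\<lambda>(v, y). snd d (\<phi> v (chart_inv c y)))
          in \<forall>z\<in>S. \<Phi> differentiable (at z) \<and>
               (\<exists>\<epsilon>>0. \<exists>K. \<forall>z1 \<in> S \<inter> ball z \<epsilon>. \<forall>z2 \<in> S \<inter> ball z \<epsilon>.
                  onorm (\<lambda>w. frechet_derivative \<Phi> (at z1) w - frechet_derivative \<Phi> (at z2) w)
                    \<le> K * norm (z1 - z2) powr \<alpha>)"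
    using action unfolding C1plus_action_def by blast
  have **: "flow_rep c d differentiable (at z) \<and>
               (\<exists>\<epsilon>>0. \<exists>K. \<forall>z1 \<in> flow_dom c d \<inter> ball z \<epsilon>. \<forall>z2 \<in> flow_dom c d \<inter> ball z \<epsilon>.
                  onorm (\<lambda>w. flow_deriv c d z1 w - flow_deriv c d z2 w)
                    \<le> K * norm (z1 - z2) powr \<alpha>)"
    using * assms unfolding Let_def flow_rep_def[symmetric] flow_dom_def[symmetric] by blast
  then show "flow_rep c d differentiable (at z)" by blast
  show "\<exists>\<alpha>>0. \<exists>\<epsilon>>0. \<exists>K. \<forall>z1 \<in> flow_dom c d \<inter> ball z \<epsilon>. \<forall>z2 \<in> flow_dom c d \<inter> ball z \<epsilon>.
      onorm (\<lambda>w. flow_deriv c d z1 w - flow_deriv c d z2 w) \<le> K * norm (z1 - z2) powr \<alpha>"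
    using ** \<open>\<alpha> > 0\<close> by blast
qed

lemma flow_rep_has_derivative:
  assumes "c \<in> A" "d \<in> A" "z \<in> flow_dom c d"
  shows "(flow_rep c d has_derivative flow_deriv c d z) (at z)"
  using flow_rep_regular(1)[OF assms] by (simp add: frechet_derivative_works)

lemma linear_flow_deriv:
  assumes "c \<in> A" "d \<in> A" "z \<in> flow_dom c d"
  shows "linear (flow_deriv c d z)"
  using flow_rep_has_derivative[OF assms] has_derivative_linear by blast

text \<open>Comparing a variable \<open>z1\<close> with the centre \<open>z\<close> in the Hoelder
  estimate bounds the difference by \<open>K * norm (z1 - z) powr \<alpha> * norm w\<close>, which
  tends to 0.\<close>

lemma continuous_flow_deriv:
  assumes "c \<in> A" "d \<in> A"
  shows "continuous_on (flow_dom c d) (\<lambda>z. flow_deriv c d z w)"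
  unfolding continuous_on_def
proof
  fix z assume z: "z \<in> flow_dom c d"
  obtain \<alpha> \<epsilon> K where \<alpha>: "\<alpha> > (0::real)" and \<epsilon>: "\<epsilon> > 0"
    and K': "\<forall>z1 \<in> flow_dom c d \<inter> ball z \<epsilon>. \<forall>z2 \<in> flow_dom c d \<inter> ball z \<epsilon>.
      onorm (\<lambda>w. flow_deriv c d z1 w - flow_deriv c d z2 w) \<le> K * norm (z1 - z2) powr \<alpha>"
    using flow_rep_regular(2)[OF assms z] by (elim exE conjE) (rule that)
  have K: "onorm (\<lambda>w. flow_deriv c d z1 w - flow_deriv c d z w) \<le> K * norm (z1 - z) powr \<alpha>"
    if "z1 \<in> flow_dom c d \<inter> ball z \<epsilon>" for z1
    using K'[THEN bspec, OF that, THEN bspec, of z] z \<epsilon> by simp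
  let ?F = "at z within flow_dom c d"
  have "((\<lambda>z1. norm (z1 - z)) \<longlongrightarrow> norm (z - z)) ?F"
    by (intro tendsto_intros)
  then have "((\<lambda>z1. norm (z1 - z) powr \<alpha>) \<longlongrightarrow> 0) ?F"
    using \<alpha> by (intro tendsto_zero_powrI[where b=\<alpha>]) auto
  then have lim: "((\<lambda>z1. K * norm (z1 - z) powr \<alpha> * norm w) \<longlongrightarrow> 0) ?F"
    by (auto intro!: tendsto_mult_left_zero tendsto_mult_right_zero)
  have "\<forall>\<^sub>F z1 in ?F. z1 \<in> flow_dom c d \<inter> ball z \<epsilon>"
    using \<epsilon> by (auto simp: eventually_at dist_commute intro!: exI[of _ \<epsilon>])
  then have "\<forall>\<^sub>F z1 in ?F. norm (flow_deriv c d z1 w - flow_deriv c d z w) \<le> K * norm (z1 - z) powr \<alpha> * norm w"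
  proof eventually_elim
    case (elim z1)
    have "linear (\<lambda>w. flow_deriv c d z1 w - flow_deriv c d z w)"
      using elim z assms by (intro linear_compose_sub linear_flow_deriv) auto
    then have "norm (flow_deriv c d z1 w - flow_deriv c d z w)
        \<le> onorm (\<lambda>w. flow_deriv c d z1 w - flow_deriv c d z w) * norm w"
      using onorm[of "\<lambda>w. flow_deriv c d z1 w - flow_deriv c d z w"]
      by (simp add: linear_conv_bounded_linear)
    also have "\<dots> \<le> K * norm (z1 - z) powr \<alpha> * norm w"
      using K[OF elim] by (intro mult_right_mono) auto
    finally show ?case .
  qed
  then show "((\<lambda>z. flow_deriv c d z w) \<longlongrightarrow> flow_deriv c d z w) ?F"
    using lim by (subst LIM_zero_iff[symmetric]) (rule Lim_null_comparison)
qed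

text \<open>The derivative of a single \<open>\<phi> v\<close> is the partial derivative of the
  joint map in the space variable. Continuity and bounds are proved for the joint map and
  transferred through the second part.\<close>

lemma chart_deriv_act:
  assumes "c \<in> A" "d \<in> A" "p \<in> fst c" "\<phi> v p \<in> fst d"
  shows "((snd d \<circ> \<phi> v \<circ> chart_inv c) has_derivative chart_deriv c d (\<phi> v) p) (at (snd c p))"
    and "chart_deriv c d (\<phi> v) p w = flow_deriv c d (v, snd c p) (0, w)"
proof -
  have "((\<lambda>y. flow_rep c d (v, y)) has_derivative (\<lambda>w. flow_deriv c d (v, snd c p) (0, w))) (at (snd c p))"
    by (rule has_derivative_compose[OF _ flow_rep_has_derivative[OF assms(1,2)]])
      (use flow_domI assms in \<open>auto intro!: derivative_eq_intros\<close>)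
  then have *: "((snd d \<circ> \<phi> v \<circ> chart_inv c) has_derivative (\<lambda>w. flow_deriv c d (v, snd c p) (0, w))) (at (snd c p))"
    by (simp add: flow_rep_def o_def)
  then have "chart_deriv c d (\<phi> v) p = (\<lambda>w. flow_deriv c d (v, snd c p) (0, w))"
    unfolding chart_deriv_def by (metis frechet_derivative_at)
  with * show "((snd d \<circ> \<phi> v \<circ> chart_inv c) has_derivative chart_deriv c d (\<phi> v) p) (at (snd c p))"
    and "chart_deriv c d (\<phi> v) p w = flow_deriv c d (v, snd c p) (0, w)"
    by auto
qed

lemma generator_eq:
  assumes "c \<in> A" "p \<in> fst c"
  shows "((\<lambda>v. snd c (\<phi> v p)) has_derivative generator c p) (at 0)"
    and "generator c p u = flow_deriv c c (0, snd c p) (u, 0)"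
proof -
  have "((\<lambda>v. flow_rep c c (v, snd c p)) has_derivative (\<lambda>u. flow_deriv c c (0, snd c p) (u, 0))) (at 0)"
    by (rule has_derivative_compose[OF _ flow_rep_has_derivative[OF assms(1,1)]])
      (use flow_domI assms in \<open>auto intro!: derivative_eq_intros\<close>)
  then have *: "((\<lambda>v. snd c (\<phi> v p)) has_derivative (\<lambda>u. flow_deriv c c (0, snd c p) (u, 0))) (at 0)"
    using assms by (simp add: flow_rep_def o_def)
  then have "generator c p = (\<lambda>u. flow_deriv c c (0, snd c p) (u, 0))"
    unfolding generator_def by (metis frechet_derivative_at)
  with * show "((\<lambda>v. snd c (\<phi> v p)) has_derivative generator c p) (at 0)"
    and "generator c p u = flow_deriv c c (0, snd c p) (u, 0)"
    by auto
qed

lemma linear_generator: "c \<in> A \<Longrightarrow> p \<in> fst c \<Longrightarrow> linear (generator c p)"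
  using generator_eq(1) has_derivative_linear by blast

lemma orbit_tangent_eq: "orbit_tangent \<phi> c p = range (generator c p)"
  by (simp add: orbit_tangent_def generator_def)

lemma continuous_generator:
  assumes "c \<in> A"
  shows "continuous_on (fst c) (\<lambda>p. generator c p u)"
proof -
  have "continuous_on (fst c) (\<lambda>p. flow_deriv c c (0, snd c p) (u, 0))"
  proof (rule continuous_on_compose2[OF continuous_flow_deriv[OF assms assms]])
    show "continuous_on (fst c) (\<lambda>p. (0 :: real^'k, snd c p))"
      by (intro continuous_on_Pair continuous_on_const continuous_chart assms)
    show "(\<lambda>p. (0, snd c p)) ` fst c \<subseteq> flow_dom c c"
      using flow_domI[OF _ assms] by (simp add: image_subset_iff)
  qed
  then show ?thesis
    by (rule continuous_on_eq) (use generator_eq(2) assms in auto)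
qed

lemma eventually_act_in_chart:
  assumes "c \<in> A" "d \<in> A" "p \<in> fst c" "\<phi> v p \<in> fst d"
  shows "\<forall>\<^sub>F y in nhds (snd c p). y \<in> snd c ` fst c \<and> \<phi> v (chart_inv c y) \<in> fst d"
proof -
  have "\<forall>\<^sub>F z in nhds (v, snd c p). z \<in> flow_dom c d"
    using open_flow_dom[OF assms(1,2)] flow_domI assms by (intro eventually_nhds_in_open) auto
  moreover have "filterlim (\<lambda>y. (v, y)) (nhds (v, snd c p)) (nhds (snd c p))"
    by (intro tendsto_intros filterlim_ident)
  ultimately have "\<forall>\<^sub>F y in nhds (snd c p). (v, y) \<in> flow_dom c d"
    by (auto simp: filterlim_iff)
  then show ?thesis by (simp add: flow_dom_def)
qed

text \<open>The cocycle rule, with an arbitrary intermediate chart \<open>e\<close>. Since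
  \<open>\<phi> 0\<close> is the identity, the cases \<open>u = 0\<close> and \<open>v = 0\<close>
  are the change of charts at the end and at the start.\<close>

lemma chart_deriv_chain:
  assumes "c \<in> A" "d \<in> A" "e \<in> A" "p \<in> fst c" "\<phi> v p \<in> fst e" "\<phi> (u + v) p \<in> fst d"
  shows "chart_deriv c d (\<phi> (u + v)) p w = chart_deriv e d (\<phi> u) (\<phi> v p) (chart_deriv c e (\<phi> v) p w)"
proof -
  have 1: "((snd e \<circ> \<phi> v \<circ> chart_inv c) has_derivative chart_deriv c e (\<phi> v) p) (at (snd c p))"
    using assms by (intro chart_deriv_act)
  have 2: "((snd d \<circ> \<phi> u \<circ> chart_inv e) has_derivative chart_deriv e d (\<phi> u) (\<phi> v p))
      (at ((snd e \<circ> \<phi> v \<circ> chart_inv c) (snd c p)))"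
    using chart_deriv_act(1)[of e d "\<phi> v p" u] assms by (simp add: act_add)
  have "((snd d \<circ> \<phi> u \<circ> chart_inv e) \<circ> (snd e \<circ> \<phi> v \<circ> chart_inv c) has_derivative
      chart_deriv e d (\<phi> u) (\<phi> v p) \<circ> chart_deriv c e (\<phi> v) p) (at (snd c p))"
    using 1 2 by (rule diff_chain_at)
  moreover have "\<forall>\<^sub>F y in nhds (snd c p). ((snd d \<circ> \<phi> u \<circ> chart_inv e) \<circ> (snd e \<circ> \<phi> v \<circ> chart_inv c)) y
      = (snd d \<circ> \<phi> (u + v) \<circ> chart_inv c) y"
    using eventually_act_in_chart[OF assms(1,3,4,5)]
    by eventually_elim (use assms in \<open>simp add: act_add\<close>)
  ultimately have "((snd d \<circ> \<phi> (u + v) \<circ> chart_inv c) has_derivative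
      chart_deriv e d (\<phi> u) (\<phi> v p) \<circ> chart_deriv c e (\<phi> v) p) (at (snd c p))"
    by (rule has_derivative_transform_nhds)
  then show ?thesis
    using has_derivative_unique[OF chart_deriv_act(1)[OF assms(1,2,4,6)]] by (metis comp_apply)
qed

text \<open>The curve \<open>\<kappa>\<close> moves the group element by
  \<open>\<tau> *\<^sub>R u\<close> and the point back by the same amount, so its image under the
  action is constantly \<open>\<phi> v p\<close>; differentiate at \<open>\<tau> = 0\<close>. This
  is the cancellation behind the removal of the orbit component of a velocity.\<close>

lemma flow_deriv_along_orbit:
  assumes "c \<in> A" "d \<in> A" "p \<in> fst c" "\<phi> v p \<in> fst d"
  shows "flow_deriv c d (v, snd c p) (u, - generator c p u) = 0"
proof -
  define \<kappa> where "\<kappa> = (\<lambda>\<tau>. (v + \<tau> *\<^sub>R u, snd c (\<phi> (- \<tau> *\<^sub>R u) p)))"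
  have inner: "((\<lambda>\<tau>::real. - \<tau> *\<^sub>R u) has_derivative (\<lambda>\<tau>. - \<tau> *\<^sub>R u)) (at 0)"
    by (auto intro!: derivative_eq_intros)
  have "((\<lambda>\<tau>. snd c (\<phi> (- \<tau> *\<^sub>R u) p)) has_derivative (\<lambda>\<tau>. generator c p (- \<tau> *\<^sub>R u))) (at 0)"
    by (rule has_derivative_compose[OF inner]) (use generator_eq(1)[OF assms(1,3)] in simp)
  then have "(\<kappa> has_derivative (\<lambda>\<tau>. (\<tau> *\<^sub>R u, generator c p (- \<tau> *\<^sub>R u)))) (at 0)"
    unfolding \<kappa>_def by (auto intro!: derivative_eq_intros)
  then have "((\<lambda>\<tau>. flow_rep c d (\<kappa> \<tau>)) has_derivative
      (\<lambda>\<tau>. flow_deriv c d (v, snd c p) (\<tau> *\<^sub>R u, generator c p (- \<tau> *\<^sub>R u)))) (at 0)"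
    by (rule has_derivative_compose)
      (use flow_rep_has_derivative[OF assms(1,2), of "\<kappa> 0"] flow_domI assms in \<open>auto simp: \<kappa>_def\<close>)
  moreover have "((\<lambda>\<tau>. flow_rep c d (\<kappa> \<tau>)) has_derivative (\<lambda>_. 0)) (at 0)"
  proof -
    have "((\<lambda>\<tau>. \<phi> (- \<tau> *\<^sub>R u) p) \<longlongrightarrow> \<phi> (- 0 *\<^sub>R u) p) (at (0::real))"
      by (intro tendsto_act tendsto_intros)
    then have "\<forall>\<^sub>F \<tau> in at (0::real). \<phi> (- \<tau> *\<^sub>R u) p \<in> fst c"
      using assms(3) by (intro topological_tendstoD[OF _ open_chart[OF assms(1)]]) auto
    then have "\<forall>\<^sub>F \<tau> in at (0::real). snd d (\<phi> v p) = flow_rep c d (\<kappa> \<tau>)"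
      by eventually_elim (use assms in \<open>auto simp: flow_rep_def \<kappa>_def simp flip: act_add\<close>)
    then show ?thesis
      by (rule has_derivative_transform_eventually[OF has_derivative_const])
        (use assms in \<open>auto simp: flow_rep_def \<kappa>_def\<close>)
  qed
  ultimately have "(\<lambda>\<tau>. flow_deriv c d (v, snd c p) (\<tau> *\<^sub>R u, generator c p (- \<tau> *\<^sub>R u))) = (\<lambda>_. 0)"
    by (rule has_derivative_unique)
  from fun_cong[OF this, of 1] show ?thesis
    using linear_neg[OF linear_generator[OF assms(1,3)]] by simp
qed

text \<open>If the velocity of \<open>\<tau> \<mapsto> \<phi> (\<tau> *\<^sub>R u) p\<close>
  vanishes at 0, it vanishes at every nearby \<open>\<tau>\<close>, because
  \<open>\<phi> (t *\<^sub>R u) p\<close> is the image under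
  \<open>\<phi> (\<tau> *\<^sub>R u)\<close> of \<open>\<phi> ((t - \<tau>) *\<^sub>R u) p\<close>.
  The curve is then locally constant, and arbitrarily small multiples of \<open>u\<close> are
  isotropic, contrary to discreteness at 0.\<close>

lemma inj_generator:
  assumes "locally_free \<phi>" "c \<in> A" "p \<in> fst c" "generator c p u = 0"
  shows "u = 0"
proof (rule ccontr)
  assume "u \<noteq> 0"
  have cont: "continuous_on UNIV (\<lambda>\<tau>::real. \<phi> (\<tau> *\<^sub>R u) p)"
    by (intro continuous_intros)
  then have op: "open ((\<lambda>\<tau>::real. \<phi> (\<tau> *\<^sub>R u) p) -` fst c)"
    by (rule open_vimage[OF open_chart[OF assms(2)]])
  have "0 \<in> (\<lambda>\<tau>::real. \<phi> (\<tau> *\<^sub>R u) p) -` fst c"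
    using assms(3) by simp
  with op obtain \<delta> where \<delta>: "\<delta> > 0" "ball 0 \<delta> \<subseteq> (\<lambda>\<tau>::real. \<phi> (\<tau> *\<^sub>R u) p) -` fst c"
    by (rule openE)
  have "((\<lambda>\<tau>. snd c (\<phi> (\<tau> *\<^sub>R u) p)) has_derivative (\<lambda>h. 0)) (at \<tau> within ball 0 \<delta>)" if "\<tau> \<in> ball 0 \<delta>" for \<tau>
  proof -
    have \<tau>: "\<phi> (\<tau> *\<^sub>R u) p \<in> fst c" using \<delta> that by auto
    have inner: "((\<lambda>t. (t - \<tau>) *\<^sub>R u) has_derivative (\<lambda>t. t *\<^sub>R u)) (at \<tau>)"
      by (auto intro!: derivative_eq_intros)
    have "((\<lambda>t. snd c (\<phi> ((t - \<tau>) *\<^sub>R u) p)) has_derivative (\<lambda>t. generator c p (t *\<^sub>R u))) (at \<tau>)"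
      by (rule has_derivative_compose[OF inner]) (use generator_eq(1)[OF assms(2,3)] in simp)
    then have "((\<lambda>t. snd c (\<phi> ((t - \<tau>) *\<^sub>R u) p)) has_derivative (\<lambda>t. 0)) (at \<tau>)"
      using assms(4) linear_scale[OF linear_generator[OF assms(2,3)]] by simp
    moreover have "((snd c \<circ> \<phi> (\<tau> *\<^sub>R u) \<circ> chart_inv c) has_derivative chart_deriv c c (\<phi> (\<tau> *\<^sub>R u)) p)
        (at (snd c (\<phi> ((\<tau> - \<tau>) *\<^sub>R u) p)))"
      using chart_deriv_act(1)[OF assms(2,2,3) \<tau>] by simp
    ultimately have "((\<lambda>t. (snd c \<circ> \<phi> (\<tau> *\<^sub>R u) \<circ> chart_inv c) (snd c (\<phi> ((t - \<tau>) *\<^sub>R u) p))) has_derivative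
        (\<lambda>t. chart_deriv c c (\<phi> (\<tau> *\<^sub>R u)) p 0)) (at \<tau>)"
      by (rule has_derivative_compose)
    moreover have "chart_deriv c c (\<phi> (\<tau> *\<^sub>R u)) p 0 = 0"
      using chart_deriv_act(1)[OF assms(2,2,3) \<tau>] has_derivative_linear linear_0 by blast
    moreover have "\<forall>\<^sub>F t in nhds \<tau>. (snd c \<circ> \<phi> (\<tau> *\<^sub>R u) \<circ> chart_inv c) (snd c (\<phi> ((t - \<tau>) *\<^sub>R u) p))
        = snd c (\<phi> (t *\<^sub>R u) p)"
    proof -
      have "((\<lambda>t. \<phi> ((t - \<tau>) *\<^sub>R u) p) \<longlongrightarrow> \<phi> ((\<tau> - \<tau>) *\<^sub>R u) p) (nhds \<tau>)"
        by (intro tendsto_act tendsto_intros filterlim_ident)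
      then have "\<forall>\<^sub>F t in nhds \<tau>. \<phi> ((t - \<tau>) *\<^sub>R u) p \<in> fst c"
        using open_chart[OF assms(2)] assms(3) by (auto intro: topological_tendstoD)
      then show ?thesis
        by eventually_elim (use assms in \<open>simp add: algebra_simps flip: act_add\<close>)
    qed
    ultimately have "((\<lambda>t. snd c (\<phi> (t *\<^sub>R u) p)) has_derivative (\<lambda>h. 0)) (at \<tau>)"
      using has_derivative_transform_nhds by (simp only:)
    then show ?thesis by (rule has_derivative_at_withinI)
  qed
  then obtain k where k: "\<And>\<tau>. \<tau> \<in> ball 0 \<delta> \<Longrightarrow> snd c (\<phi> (\<tau> *\<^sub>R u) p) = k"
    using has_derivative_zero_constant[of "ball (0::real) \<delta>" "\<lambda>\<tau>. snd c (\<phi> (\<tau> *\<^sub>R u) p)"] by auto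
  have fixed: "\<phi> (\<tau> *\<^sub>R u) p = p" if "\<tau> \<in> ball 0 \<delta>" for \<tau>
  proof -
    have "snd c (\<phi> (\<tau> *\<^sub>R u) p) = snd c p"
      using k[OF that] k[of 0] \<delta>(1) by simp
    then show ?thesis
      using that \<delta>(2) assms(2,3) chart_inv_chart by (metis subsetD vimageE)
  qed
  have "0 isolated_in isotropy \<phi> p"
    using assms(1) unfolding locally_free_def by (auto simp: discrete_def isotropy_def)
  then obtain e where e: "e > 0" "\<And>v. v \<in> isotropy \<phi> p \<Longrightarrow> dist 0 v < e \<Longrightarrow> v = 0"
    unfolding isolated_in_dist_Ex_iff by blast
  define \<tau> where "\<tau> = min (\<delta> / 2) (e / (2 * norm u))"
  have "\<tau> > 0" using \<delta> e \<open>u \<noteq> 0\<close> by (simp add: \<tau>_def)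
  have "\<tau> * norm u \<le> e / (2 * norm u) * norm u"
    by (intro mult_right_mono) (auto simp: \<tau>_def)
  then have "norm (\<tau> *\<^sub>R u) < e" using \<open>u \<noteq> 0\<close> \<open>\<tau> > 0\<close> e by simp
  moreover have "\<tau> \<in> ball 0 \<delta>" using \<open>\<tau> > 0\<close> \<delta> by (simp add: \<tau>_def)
  ultimately have "\<tau> *\<^sub>R u = 0"
    using fixed[of \<tau>] e(2)[of "\<tau> *\<^sub>R u"] by (simp add: isotropy_def)
  then show False using \<open>\<tau> > 0\<close> \<open>u \<noteq> 0\<close> by simp
qed

end

section \<open>Contraction along plaques\<close>

locale riemannian_action = manifold_action A \<phi>
  for A :: "('m::topological_space, 'e::euclidean_space) chart set"
    and \<phi> :: "real^'k \<Rightarrow> 'm \<Rightarrow> 'm" +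
  fixes G :: "('m, 'e) chart \<Rightarrow> 'm \<Rightarrow> 'e \<Rightarrow> 'e \<Rightarrow> real"
  assumes metric: "riemannian_metric A G"
begin

section \<open>Comparison of Riemannian and coordinate norms, and bounds for the derivative of the
  action\<close>

abbreviation tnorm where "tnorm \<equiv> tangent_norm G"

lemma bilinear_metric: "c \<in> A \<Longrightarrow> p \<in> fst c \<Longrightarrow> bilinear (G c p)"
  and metric_pos: "c \<in> A \<Longrightarrow> p \<in> fst c \<Longrightarrow> w \<noteq> 0 \<Longrightarrow> G c p w w > 0"
  and metric_change: "c \<in> A \<Longrightarrow> d \<in> A \<Longrightarrow> p \<in> fst c \<Longrightarrow> p \<in> fst d \<Longrightarrow>
    G c p u w = G d p (chart_deriv c d id p u) (chart_deriv c d id p w)"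
  and smooth_metric: "c \<in> A \<Longrightarrow> smooth_on (snd c ` fst c) (\<lambda>y. G c (chart_inv c y) u w)"
  using metric unfolding riemannian_metric_def by blast+

lemma metric_nonneg: "c \<in> A \<Longrightarrow> p \<in> fst c \<Longrightarrow> G c p w w \<ge> 0"
  using metric_pos[of c p w] bilinear_lzero[OF bilinear_metric, of c p w] by (cases "w = 0") auto

lemma tnorm_nonneg: "c \<in> A \<Longrightarrow> p \<in> fst c \<Longrightarrow> tnorm c p w \<ge> 0"
  using metric_nonneg by (simp add: tangent_norm_def)

lemma tnorm_change:
  assumes "c \<in> A" "d \<in> A" "p \<in> fst c" "p \<in> fst d"
  shows "tnorm d p (chart_deriv c d (\<phi> 0) p w) = tnorm c p w"
  using metric_change[OF assms] by (simp add: tangent_norm_def act_zero_id)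

lemma continuous_metric:
  assumes "c \<in> A"
  shows "continuous_on (fst c) (\<lambda>p. G c p u w)"
proof -
  have "continuous_on (snd c ` fst c) (\<lambda>y. G c (chart_inv c y) u w)"
    using smooth_metric[OF assms, of u w] unfolding smooth_on_def by (metis Cn_on.simps(1))
  then have "continuous_on (fst c) (\<lambda>p. G c (chart_inv c (snd c p)) u w)"
    by (rule continuous_on_compose2[OF _ continuous_chart[OF assms]]) auto
  then show ?thesis
    by (rule continuous_on_eq) (use assms in auto)
qed

lemma tnorm_comparable:
  assumes c: "c \<in> A" "p \<in> fst c"
  obtains N a b where "open N" "p \<in> N" "N \<subseteq> fst c" "a > 0" "b > 0"
    "\<And>q w. q \<in> N \<Longrightarrow> a * norm w \<le> tnorm c q w"
    "\<And>q w. q \<in> N \<Longrightarrow> tnorm c q w \<le> b * norm w"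
proof -
  \<comment> \<open>\<open>L q\<close> is the Gram operator of the metric relative to the Euclidean
    inner product: a family of linear maps, to which the perturbation lemmas apply, from which the
    quadratic form is recovered as \<open>L q w \<bullet> w\<close>.\<close>
  define L where "L = (\<lambda>q w. \<Sum>j\<in>Basis. G c q w j *\<^sub>R j)"
  have L: "L q w \<bullet> w = G c q w w" if "q \<in> fst c" for q w
  proof -
    interpret g: linear "G c q w"
      using bilinear_metric[OF c(1) that] by (simp add: bilinear_def)
    have "G c q w (\<Sum>j\<in>Basis. (w \<bullet> j) *\<^sub>R j) = (\<Sum>j\<in>Basis. (w \<bullet> j) * G c q w j)"
      by (simp only: g.sum g.scaleR real_scaleR_def)
    then have "G c q w w = (\<Sum>j\<in>Basis. (w \<bullet> j) * G c q w j)"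
      by (simp only: euclidean_representation)
    then show ?thesis
      by (simp add: L_def inner_commute[of _ w] inner_sum_right mult.commute)
  qed
  have lin: "linear (L q)" if "q \<in> fst c" for q
  proof -
    have "linear (\<lambda>w. G c q w j)" for j
      using bilinear_metric[OF c(1) that] by (simp add: bilinear_def)
    then have "linear (\<lambda>w. G c q w j *\<^sub>R j)" for j
      by (simp add: linear_iff scaleR_add_left)
    then show ?thesis
      unfolding L_def by (intro linear_compose_sum ballI)
  qed
  have cont: "continuous_on (fst c) (\<lambda>q. L q w)" for w
    unfolding L_def by (intro continuous_intros continuous_metric c)
  \<comment> \<open>Positive definiteness at \<open>p\<close> becomes quantitative by minimising
    over the compact unit sphere. Moving to nearby \<open>q\<close> then costs at most
    \<open>m/2\<close>.\<close>
  have "\<exists>m>0. \<forall>w. m * norm w ^ 2 \<le> G c p w w"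
  proof -
    have sphere: "compact (sphere (0::'e) 1)" "sphere (0::'e) 1 \<noteq> {}" by auto
    have "continuous_on (sphere 0 1) (\<lambda>w. L p w \<bullet> w)"
      using linear_continuous_on[OF linear_conv_bounded_linear[THEN iffD1, OF lin[OF c(2)]]]
      by (intro continuous_on_inner continuous_on_id)
    then obtain w0 where w0: "w0 \<in> sphere 0 1" "\<And>w. w \<in> sphere 0 1 \<Longrightarrow> L p w0 \<bullet> w0 \<le> L p w \<bullet> w"
      using continuous_attains_inf[OF sphere] by blast
    have "G c p w0 w0 * norm w ^ 2 \<le> G c p w w" for w
    proof (cases "w = 0")
      case True
      then show ?thesis using metric_nonneg[OF c] by simp
    next
      case False
      define w1 where "w1 = w /\<^sub>R norm w"
      have w: "w = norm w *\<^sub>R w1" "w1 \<in> sphere 0 1" using False by (auto simp: w1_def)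
      have "G c p w w = norm w ^ 2 * G c p w1 w1"
        using bilinear_metric[OF c] by (subst (1 2) w(1))
          (simp add: bilinear_lmul bilinear_rmul power2_eq_square)
      moreover have "G c p w0 w0 \<le> G c p w1 w1"
        using w0(2)[OF w(2)] L[OF c(2)] by simp
      ultimately show ?thesis by (simp add: mult.commute mult_right_mono)
    qed
    moreover have "w0 \<noteq> 0" using w0(1) by auto
    then have "G c p w0 w0 > 0" using metric_pos[OF c] by blast
    ultimately show ?thesis by blast
  qed
  then obtain m where m: "m > 0" "\<And>w. m * norm w ^ 2 \<le> G c p w w" by blast
  obtain N1 where N1: "open N1" "p \<in> N1" "N1 \<subseteq> fst c"
    "\<And>q w. q \<in> N1 \<Longrightarrow> norm (L q w - L p w) \<le> (m/2) * norm w"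
    using linear_family_close[OF open_chart[OF c(1)] c(2) lin cont half_gt_zero[OF m(1)]] by blast
  obtain N2 M where N2: "open N2" "p \<in> N2" "N2 \<subseteq> fst c" "M > 0"
    "\<And>q w. q \<in> N2 \<Longrightarrow> norm (L q w) \<le> M * norm w"
    using linear_family_bounded_above[OF open_chart[OF c(1)] c(2) lin cont] by blast
  show thesis
  proof
    show "open (N1 \<inter> N2)" "p \<in> N1 \<inter> N2" "N1 \<inter> N2 \<subseteq> fst c" "sqrt (m/2) > 0" "sqrt M > 0"
      using N1 N2 m by auto
    fix q w assume q: "q \<in> N1 \<inter> N2"
    then have qc: "q \<in> fst c" using N1 by auto
    have "\<bar>(L q w - L p w) \<bullet> w\<bar> \<le> norm (L q w - L p w) * norm w"
      by (rule Cauchy_Schwarz_ineq2)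
    also have "\<dots> \<le> (m/2 * norm w) * norm w"
      using N1(4)[of q w] q by (intro mult_right_mono) auto
    finally have "\<bar>G c q w w - G c p w w\<bar> \<le> m/2 * norm w ^ 2"
      using L[OF qc] L[OF c(2)] by (simp add: inner_diff_left power2_eq_square mult.assoc)
    then have "m/2 * norm w ^ 2 \<le> G c q w w"
      using m(2)[of w] by linarith
    then have "sqrt (m/2 * norm w ^ 2) \<le> tnorm c q w"
      unfolding tangent_norm_def by (rule real_sqrt_le_mono)
    then show "sqrt (m/2) * norm w \<le> tnorm c q w"
      by (simp only: real_sqrt_mult real_sqrt_abs abs_norm_cancel)
    have "G c q w w \<le> norm (L q w) * norm w"
      using L[OF qc, of w] Cauchy_Schwarz_ineq2[of "L q w" w] by simp
    also have "\<dots> \<le> (M * norm w) * norm w"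
      using N2(5)[of q w] q by (intro mult_right_mono) auto
    finally have "tnorm c q w \<le> sqrt (M * norm w ^ 2)"
      unfolding tangent_norm_def by (intro real_sqrt_le_mono) (simp add: power2_eq_square mult.assoc)
    then show "tnorm c q w \<le> sqrt M * norm w"
      by (simp add: real_sqrt_mult)
  qed
qed

text \<open>The bound has to hold for all charts \<open>c\<close> and \<open>d\<close> with one
  \<open>K\<close>. It is computed in a fixed pair \<open>c0\<close>, \<open>d0\<close>, where
  coordinate norms are comparable with Riemannian ones, and transferred to the others because
  \<open>tnorm\<close> is invariant under change of charts. The constant is the bound
  \<open>M\<close> of the coordinate derivative times the comparison factors \<open>b\<close> and
  \<open>1/a\<close>.\<close>

lemma act_deriv_bounded_locally:
  obtains W K where "open W" "(v0, p0) \<in> W" "K > 0"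
    "\<And>v p c d w. (v, p) \<in> W \<Longrightarrow> c \<in> A \<Longrightarrow> d \<in> A \<Longrightarrow> p \<in> fst c \<Longrightarrow> \<phi> v p \<in> fst d \<Longrightarrow>
      tnorm d (\<phi> v p) (chart_deriv c d (\<phi> v) p w) \<le> K * tnorm c p w"
proof -
  obtain c0 where c0: "c0 \<in> A" "p0 \<in> fst c0" by (rule chart_exists)
  obtain d0 where d0: "d0 \<in> A" "\<phi> v0 p0 \<in> fst d0" by (rule chart_exists)
  obtain N1 a b1 where N1: "open N1" "p0 \<in> N1" "N1 \<subseteq> fst c0" "a > 0"
    "\<And>q w. q \<in> N1 \<Longrightarrow> a * norm w \<le> tnorm c0 q w"
    using tnorm_comparable[OF c0] by metis
  obtain N2 a2 b where N2: "open N2" "\<phi> v0 p0 \<in> N2" "N2 \<subseteq> fst d0" "b > 0"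
    "\<And>q w. q \<in> N2 \<Longrightarrow> tnorm d0 q w \<le> b * norm w"
    using tnorm_comparable[OF d0] by metis
  have z0: "(v0, snd c0 p0) \<in> flow_dom c0 d0" using flow_domI c0 d0 by simp
  have lin: "linear (\<lambda>w. flow_deriv c0 d0 z (0, w))" if "z \<in> flow_dom c0 d0" for z
    using linear_flow_deriv[OF c0(1) d0(1) that] linear_compose[of "\<lambda>w. (0, w)" "flow_deriv c0 d0 z"]
    by (simp add: o_def linear_iff)
  obtain N3 M where N3: "open N3" "(v0, snd c0 p0) \<in> N3" "N3 \<subseteq> flow_dom c0 d0" "M > 0"
    "\<And>z w. z \<in> N3 \<Longrightarrow> norm (flow_deriv c0 d0 z (0, w)) \<le> M * norm w"
    using linear_family_bounded_above[OF open_flow_dom[OF c0(1) d0(1)] z0 lin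
        continuous_flow_deriv[OF c0(1) d0(1)]] by blast
  have lim1: "(snd \<longlongrightarrow> p0) (nhds (v0, p0))" "(fst \<longlongrightarrow> v0) (nhds (v0, p0))"
    using tendsto_snd[OF filterlim_ident, of "(v0, p0)"] tendsto_fst[OF filterlim_ident, of "(v0, p0)"]
    by simp_all
  have lim2: "((\<lambda>z. \<phi> (fst z) (snd z)) \<longlongrightarrow> \<phi> v0 p0) (nhds (v0, p0))"
    using lim1 by (intro tendsto_act)
  have "(snd c0 \<longlongrightarrow> snd c0 p0) (nhds p0)"
    using continuous_chart[OF c0(1)] open_chart[OF c0(1)] c0(2) by (rule continuous_on_open_tendsto_nhds)
  then have lim3: "((\<lambda>z. (fst z, snd c0 (snd z))) \<longlongrightarrow> (v0, snd c0 p0)) (nhds (v0, p0))"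
    using lim1 by (intro tendsto_Pair filterlim_compose[of "snd c0" _ "nhds p0" snd])
  have "\<forall>\<^sub>F z in nhds (v0, p0). snd z \<in> N1 \<and> \<phi> (fst z) (snd z) \<in> N2 \<and> (fst z, snd c0 (snd z)) \<in> N3"
    using topological_tendstoD[OF lim1(1) N1(1,2)] topological_tendstoD[OF lim2 N2(1,2)]
      topological_tendstoD[OF lim3 N3(1,2)] by eventually_elim auto
  then obtain W where W: "open W" "(v0, p0) \<in> W"
    "\<And>z. z \<in> W \<Longrightarrow> snd z \<in> N1 \<and> \<phi> (fst z) (snd z) \<in> N2 \<and> (fst z, snd c0 (snd z)) \<in> N3"
    unfolding eventually_nhds by blast
  show thesis
  proof
    show "open W" "(v0, p0) \<in> W" "b * M / a > 0" using W N1 N2 N3 by auto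
    fix v p c d w assume vp: "(v, p) \<in> W" and cd: "c \<in> A" "d \<in> A" "p \<in> fst c" "\<phi> v p \<in> fst d"
    have in_N: "p \<in> N1" "\<phi> v p \<in> N2" "(v, snd c0 p) \<in> N3" using W(3)[OF vp] by auto
    then have in_chart: "p \<in> fst c0" "\<phi> v p \<in> fst d0" using N1 N2 by auto
    define w0 where "w0 = chart_deriv c c0 (\<phi> 0) p w"
    have "chart_deriv c d (\<phi> v) p w = chart_deriv c0 d (\<phi> v) p w0"
      using chart_deriv_chain[of c d c0 p 0 v w] cd c0 in_chart by (simp add: w0_def)
    also have "\<dots> = chart_deriv d0 d (\<phi> 0) (\<phi> v p) (chart_deriv c0 d0 (\<phi> v) p w0)"
      using chart_deriv_chain[of c0 d d0 p v 0 w0] cd c0 d0 in_chart by simp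
    finally have "tnorm d (\<phi> v p) (chart_deriv c d (\<phi> v) p w) = tnorm d0 (\<phi> v p) (chart_deriv c0 d0 (\<phi> v) p w0)"
      using tnorm_change[of d0 d "\<phi> v p"] d0(1) cd in_chart by simp
    also have "\<dots> \<le> b * norm (chart_deriv c0 d0 (\<phi> v) p w0)"
      using N2(5)[OF in_N(2)] .
    also have "\<dots> \<le> b * (M * norm w0)"
      using N3(5)[OF in_N(3), of w0] chart_deriv_act(2)[OF c0(1) d0(1) in_chart, of w0] N2(4) by simp
    also have "\<dots> \<le> b * (M * (tnorm c0 p w0 / a))"
      using N1(5)[OF in_N(1), of w0] N1(4) N2(4) N3(4)
      by (intro mult_left_mono) (auto simp: field_simps)
    also have "tnorm c0 p w0 = tnorm c p w"
      using tnorm_change[of c c0 p w] cd c0 in_chart by (simp add: w0_def)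
    finally show "tnorm d (\<phi> v p) (chart_deriv c d (\<phi> v) p w) \<le> b * M / a * tnorm c p w"
      by simp
  qed
qed

lemma act_deriv_bounded:
  assumes "compact (UNIV :: 'm set)"
  obtains K where "K > 0"
    "\<And>v p c d w. norm v \<le> R \<Longrightarrow> c \<in> A \<Longrightarrow> d \<in> A \<Longrightarrow> p \<in> fst c \<Longrightarrow> \<phi> v p \<in> fst d \<Longrightarrow>
      tnorm d (\<phi> v p) (chart_deriv c d (\<phi> v) p w) \<le> K * tnorm c p w"
proof -
  define P where "P = (\<lambda>W K. open W \<and> K > 0 \<and> (\<forall>v p c d w. (v, p) \<in> W \<longrightarrow> c \<in> A \<longrightarrow> d \<in> A \<longrightarrow>
    p \<in> fst c \<longrightarrow> \<phi> v p \<in> fst d \<longrightarrow> tnorm d (\<phi> v p) (chart_deriv c d (\<phi> v) p w) \<le> K * tnorm c p w))"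
  let ?C = "cball (0 :: real^'k) R \<times> (UNIV :: 'm set)"
  have "\<exists>W K. z \<in> W \<and> P W K" for z
    unfolding P_def by (cases z) (rule act_deriv_bounded_locally, blast)
  then obtain W K where WK: "\<And>z. z \<in> W z \<and> P (W z) (K z)" by metis
  have "compact ?C" using assms by (intro compact_Times compact_cball)
  then obtain D where D: "finite D" "?C \<subseteq> (\<Union>z\<in>D. W z)"
  proof (rule compactE_image)
    show "open (W z)" for z using WK by (simp add: P_def)
    show "?C \<subseteq> (\<Union>z\<in>?C. W z)" using WK by blast
  qed
  \<comment> \<open>The 1 keeps \<open>k\<close> positive even if \<open>D\<close> is empty, which
    can happen for negative \<open>R\<close>.\<close>
  define k where "k = Max (insert 1 (K ` D))"
  have k: "K z \<le> k" if "z \<in> D" for z using that D(1) by (auto simp: k_def)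
  show thesis
  proof
    have "1 \<le> k" using D(1) by (auto simp: k_def)
    then show "k > 0" by simp
    fix v p c d w assume v: "norm v \<le> R" and cd: "c \<in> A" "d \<in> A" "p \<in> fst c" "\<phi> v p \<in> fst d"
    have "(v, p) \<in> ?C" using v by simp
    then obtain z where z: "z \<in> D" "(v, p) \<in> W z" using D(2) by blast
    have "tnorm d (\<phi> v p) (chart_deriv c d (\<phi> v) p w) \<le> K z * tnorm c p w"
      using WK[of z] z cd unfolding P_def by blast
    also have "\<dots> \<le> k * tnorm c p w"
      using k[OF z(1)] tnorm_nonneg cd by (intro mult_right_mono) auto
    finally show "tnorm d (\<phi> v p) (chart_deriv c d (\<phi> v) p w) \<le> k * tnorm c p w" .
  qed
qed

text \<open>A curve with this property stands in for the statement that its end points have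
  Riemannian distance at most \<open>\<epsilon>\<close>, so that no distance function need be
  constructed. The bound is required in every chart met by the curve; the derivatives at 0 and 1 are
  one-sided.\<close>

definition speed_at_most :: "real \<Rightarrow> (real \<Rightarrow> 'm) \<Rightarrow> bool" where
  "speed_at_most \<epsilon> \<gamma> \<longleftrightarrow> continuous_on {0..1} \<gamma> \<and>
     (\<forall>t\<in>{0..1}. \<forall>d\<in>A. \<gamma> t \<in> fst d \<longrightarrow>
       (\<exists>w. ((\<lambda>t. snd d (\<gamma> t)) has_vector_derivative w) (at t within {0..1}) \<and> tnorm d (\<gamma> t) w \<le> \<epsilon>))"

text \<open>An exit time argument in one chart. The curve starts within \<open>r/2\<close> of
  \<open>y\<close> in coordinates, and as long as it stays in the coordinate ball \<open>W\<close>
  of radius \<open>r\<close>, the speed bound \<open>a * (r/4)\<close> lets it move by at most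
  \<open>r/4\<close>. It thus stays in the closed ball \<open>C\<close> of radius
  \<open>3/4 * r\<close>, and by closedness it is still there at the first exit time, a
  contradiction.\<close>

lemma slow_curves_stay_near:
  assumes "open N" "y \<in> N"
  obtains N' \<epsilon> where "open N'" "y \<in> N'" "\<epsilon> > 0"
    "\<And>\<gamma>. speed_at_most \<epsilon> \<gamma> \<Longrightarrow> \<gamma> 0 \<in> N' \<Longrightarrow> \<gamma> 1 \<in> N"
proof -
  obtain d where d: "d \<in> A" "y \<in> fst d" by (rule chart_exists)
  obtain N1 a b where N1: "open N1" "y \<in> N1" "N1 \<subseteq> fst d" "a > 0"
    "\<And>q w. q \<in> N1 \<Longrightarrow> a * norm w \<le> tnorm d q w"
    using tnorm_comparable[OF d] by metis
  have "open ((snd d ` fst d) \<inter> chart_inv d -` (N \<inter> N1))"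
    using continuous_chart_inv[OF d(1)] open_chart_image[OF d(1)] N1(1) assms(1)
    by (intro continuous_open_preimage open_Int)
  moreover have "snd d y \<in> (snd d ` fst d) \<inter> chart_inv d -` (N \<inter> N1)"
    using d N1 assms by simp
  ultimately obtain r where r: "r > 0" "cball (snd d y) r \<subseteq> (snd d ` fst d) \<inter> chart_inv d -` (N \<inter> N1)"
    using open_contains_cball by blast
  have open_pre: "open (fst d \<inter> snd d -` ball (snd d y) s)" for s
    using continuous_chart[OF d(1)] open_chart[OF d(1)] by (intro continuous_open_preimage open_ball)
  define W where "W = fst d \<inter> snd d -` ball (snd d y) r"
  have W: "W \<subseteq> N \<inter> N1"
  proof
    fix p assume "p \<in> W"
    then have "p \<in> fst d" "snd d p \<in> cball (snd d y) r" by (auto simp: W_def)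
    then have "chart_inv d (snd d p) \<in> N \<inter> N1" using r(2) by blast
    then show "p \<in> N \<inter> N1" using \<open>p \<in> fst d\<close> d(1) by simp
  qed
  define C where "C = chart_inv d ` cball (snd d y) (3/4 * r)"
  have "cball (snd d y) (3/4 * r) \<subseteq> cball (snd d y) r"
    using r(1) by (intro subset_cball) simp
  then have sub: "cball (snd d y) (3/4 * r) \<subseteq> snd d ` fst d" using r(2) by blast
  \<comment> \<open>Closedness in the whole manifold, not only in the chart domain, is what forbids
    the curve to leave the chart at the exit time. It holds because \<open>C\<close> is compact and
    the manifold is Hausdorff.\<close>
  have "closed C"
    unfolding C_def using continuous_on_subset[OF continuous_chart_inv[OF d(1)] sub]
    by (intro compact_closed compact_continuous_image compact_cball)
  have "C \<subseteq> W"
  proof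
    fix p assume "p \<in> C"
    then obtain q where q: "q \<in> cball (snd d y) (3/4 * r)" "p = chart_inv d q" by (auto simp: C_def)
    then have "q \<in> snd d ` fst d" using sub by blast
    then have "p \<in> fst d" "snd d p = q"
      using q chart_inv_in[OF d(1)] chart_chart_inv[OF d(1)] by auto
    then show "p \<in> W" using q r(1) by (auto simp: W_def)
  qed
  show thesis
  proof
    show "open (fst d \<inter> snd d -` ball (snd d y) (r/2))" by (rule open_pre)
    show "y \<in> fst d \<inter> snd d -` ball (snd d y) (r/2)" using d r by simp
    show "a * (r/4) > 0" using N1 r by simp
    fix \<gamma> assume \<gamma>: "speed_at_most (a * (r/4)) \<gamma>"
      and start: "\<gamma> 0 \<in> fst d \<inter> snd d -` ball (snd d y) (r/2)"
    have cont: "continuous_on {0..1} \<gamma>" using \<gamma> by (simp add: speed_at_most_def)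
    have "\<gamma> 1 \<in> W"
    proof (rule ccontr)
      assume "\<gamma> 1 \<notin> W"
      define T where "T = {0..1} \<inter> \<gamma> -` (- W)"
      have "closed T"
        unfolding T_def
      proof (rule continuous_closed_preimage[OF cont])
        show "closed (- W)" unfolding W_def using open_pre by (rule closed_Compl)
      qed simp
      moreover have "1 \<in> T" "bdd_below T" using \<open>\<gamma> 1 \<notin> W\<close> by (simp_all add: T_def)
      ultimately have InfT: "Inf T \<in> T" by (intro closed_contains_Inf) auto
      define t1 where "t1 = Inf T"
      have t1: "t1 \<in> {0..1}" "\<gamma> t1 \<notin> W" using InfT by (auto simp: t1_def T_def)
      have before: "\<gamma> t \<in> W" if "0 \<le> t" "t < t1" for t
        using that t1 cInf_lower[OF _ \<open>bdd_below T\<close>, of t] by (fastforce simp: t1_def T_def)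
      have "\<gamma> 0 \<in> W" using start r(1) by (auto simp: W_def)
      then have "t1 > 0" using t1 by (metis atLeastAtMost_iff le_less)
      have "\<gamma> t \<in> C" if t: "0 \<le> t" "t < t1" for t
      proof -
        have "\<exists>w. ((\<lambda>t. snd d (\<gamma> t)) has_vector_derivative w) (at s within {0..1}) \<and> norm w \<le> r/4"
          if s: "s \<in> {0..t}" for s
        proof -
          have "\<gamma> s \<in> W" "s \<in> {0..1}" using before[of s] s t t1 by auto
          then obtain w where w: "((\<lambda>t. snd d (\<gamma> t)) has_vector_derivative w) (at s within {0..1})"
            "tnorm d (\<gamma> s) w \<le> a * (r/4)"
            using \<gamma> d(1) unfolding speed_at_most_def W_def by blast
          have "a * norm w \<le> a * (r/4)"
            using N1(5)[of "\<gamma> s" w] \<open>\<gamma> s \<in> W\<close> W w(2) by auto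
          then show ?thesis using w(1) N1(4) by auto
        qed
        then obtain w where w: "\<And>s. s \<in> {0..t} \<Longrightarrow> ((\<lambda>t. snd d (\<gamma> t)) has_vector_derivative w s) (at s within {0..1})"
          "\<And>s. s \<in> {0..t} \<Longrightarrow> norm (w s) \<le> r/4" by metis
        have "norm (snd d (\<gamma> t) - snd d (\<gamma> 0)) \<le> r/4 * norm (t - 0)"
        proof (rule differentiable_bound[of "{0..t}" _ "\<lambda>s h. h *\<^sub>R w s"])
          fix s assume s: "s \<in> {0..t}"
          have "((\<lambda>t. snd d (\<gamma> t)) has_vector_derivative w s) (at s within {0..t})"
            using w(1)[OF s] by (rule has_vector_derivative_within_subset) (use t t1 in auto)
          then show "((\<lambda>t. snd d (\<gamma> t)) has_derivative (\<lambda>h. h *\<^sub>R w s)) (at s within {0..t})"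
            by (simp add: has_vector_derivative_def)
          show "onorm (\<lambda>h. h *\<^sub>R w s) \<le> r/4"
            using w(2)[OF s] by (simp add: onorm_scaleR_left onorm_id)
        qed (use t in auto)
        also have "\<dots> \<le> r/4" using t t1 r by (simp add: mult_left_le)
        finally have "dist (snd d (\<gamma> t)) (snd d (\<gamma> 0)) \<le> r/4" by (simp add: dist_norm)
        moreover have "dist (snd d (\<gamma> 0)) (snd d y) < r/2" using start by (simp add: dist_commute)
        ultimately have "dist (snd d (\<gamma> t)) (snd d y) \<le> 3/4 * r"
          using dist_triangle[of "snd d (\<gamma> t)" "snd d y" "snd d (\<gamma> 0)"] by linarith
        then have "snd d (\<gamma> t) \<in> cball (snd d y) (3/4 * r)" by (simp add: dist_commute)
        moreover have "\<gamma> t = chart_inv d (snd d (\<gamma> t))"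
          using before[OF t] d(1) by (simp add: W_def)
        ultimately show "\<gamma> t \<in> C" unfolding C_def by (metis imageI)
      qed
      then have "{0..<t1} \<subseteq> {0..1} \<inter> \<gamma> -` C" using t1 by auto
      moreover have "closed ({0..1} \<inter> \<gamma> -` C)"
        using cont \<open>closed C\<close> by (intro continuous_closed_preimage) auto
      ultimately have "closure {0..<t1} \<subseteq> {0..1} \<inter> \<gamma> -` C"
        by (rule closure_minimal)
      moreover have "t1 \<in> closure {0..<t1}" using \<open>t1 > 0\<close> by simp
      ultimately have "\<gamma> t1 \<in> C" by blast
      then show False using \<open>C \<subseteq> W\<close> t1 by blast
    qed
    then show "\<gamma> 1 \<in> N" using W by blast
  qed
qed

text \<open>A curve \<open>\<sigma>\<close> from \<open>y\<close> to \<open>z\<close> whose velocity splits as a stable part \<open>s\<close> plus the orbit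
  direction \<open>U'\<close>. Flowing back by \<open>U\<close> cancels the orbit direction, so that
  \<open>t \<mapsto> \<phi> (- U t) (\<sigma> t)\<close> is contracted by the Anosov element.\<close>
definition stable_curve ::
  "('m, 'e) plane_field \<Rightarrow> ('m, 'e) chart \<Rightarrow> real \<Rightarrow> real \<Rightarrow> 'm \<Rightarrow> 'm \<Rightarrow> bool" where
  "stable_curve E c R S y z \<longleftrightarrow>
     (\<exists>\<sigma> U u s. \<sigma> 0 = y \<and> \<sigma> 1 = z \<and> U 0 = 0 \<and>
       (\<forall>t\<in>{0..1::real}. \<sigma> t \<in> fst c \<and> norm (U t) \<le> R \<and>
          (U has_vector_derivative u t) (at t within {0..1}) \<and>
          ((\<lambda>t. snd c (\<sigma> t)) has_vector_derivative generator c (\<sigma> t) (u t) + s t) (at t within {0..1}) \<and>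
          s t \<in> E c (\<sigma> t) \<and> tnorm c (\<sigma> t) (s t) \<le> S))"

text \<open>The velocity of \<open>\<kappa>\<close> is
  \<open>(- u, generator c (\<sigma> t) u + s)\<close>. It splits as
  \<open>(- u, - generator c (\<sigma> t) (- u)) + (0, s)\<close>, whose first summand is killed by
  \<open>flow_deriv_along_orbit\<close>, so only the part \<open>s\<close> survives.\<close>

lemma flow_compensated_derivative:
  assumes c: "c \<in> A" and d: "d \<in> A"
    and \<sigma>: "\<And>t. t \<in> T \<Longrightarrow> \<sigma> t \<in> fst c" and t: "t \<in> T" "\<phi> (v - U t) (\<sigma> t) \<in> fst d"
    and U': "(U has_vector_derivative u) (at t within T)"
    and \<sigma>': "((\<lambda>t. snd c (\<sigma> t)) has_vector_derivative generator c (\<sigma> t) u + s) (at t within T)"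
  shows "((\<lambda>t. snd d (\<phi> (v - U t) (\<sigma> t))) has_vector_derivative
    chart_deriv c d (\<phi> (v - U t)) (\<sigma> t) s) (at t within T)"
proof -
  define \<kappa> where "\<kappa> = (\<lambda>t. (v - U t, snd c (\<sigma> t)))"
  have dom: "\<kappa> t \<in> flow_dom c d" using flow_domI c \<sigma> t by (simp add: \<kappa>_def)
  have "((\<lambda>t. v - U t) has_vector_derivative - u) (at t within T)"
    using has_vector_derivative_diff[OF has_vector_derivative_const U', of v] by simp
  then have "(\<kappa> has_vector_derivative (- u, generator c (\<sigma> t) u + s)) (at t within T)"
    unfolding \<kappa>_def using \<sigma>' by (rule has_vector_derivative_Pair)
  then have "(flow_rep c d \<circ> \<kappa> has_vector_derivative
      flow_deriv c d (\<kappa> t) (- u, generator c (\<sigma> t) u + s)) (at t within T)"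
    by (rule vector_derivative_diff_chain_within)
      (rule has_derivative_at_withinI[OF flow_rep_has_derivative[OF c d dom]])
  also have "flow_deriv c d (\<kappa> t) (- u, generator c (\<sigma> t) u + s)
      = flow_deriv c d (\<kappa> t) (- u, - generator c (\<sigma> t) (- u)) + flow_deriv c d (\<kappa> t) (0, s)"
    using linear_add[OF linear_flow_deriv[OF c d dom], symmetric]
      linear_neg[OF linear_generator[OF c \<sigma>[OF t(1)]], of u] by simp
  also have "\<dots> = chart_deriv c d (\<phi> (v - U t)) (\<sigma> t) s"
    using flow_deriv_along_orbit[OF c d \<sigma>[OF t(1)] t(2)] chart_deriv_act(2)[OF c d \<sigma>[OF t(1)] t(2)]
    by (simp add: \<kappa>_def)
  finally show ?thesis
    by (rule has_vector_derivative_transform[OF t(1), rotated])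
      (use c \<sigma> in \<open>simp add: flow_rep_def \<kappa>_def\<close>)
qed

text \<open>The witness is \<open>b = U 1\<close>, and the curve is
  \<open>\<gamma> t = \<phi> (real n *\<^sub>R a - U t) (\<sigma> t)\<close>. Its derivative applies
  \<open>\<phi> (real n *\<^sub>R a)\<close> first, at \<open>\<sigma> t\<close>, where
  \<open>s t\<close> is known to lie in \<open>E\<close>, gaining the factor \<open>q n\<close>;
  then \<open>\<phi> (- U t)\<close>, with \<open>norm (U t) \<le> R\<close>, loses at most the
  factor \<open>K\<close>.\<close>

lemma stable_curve_contracts:
  assumes c: "c \<in> A" and curve: "stable_curve E c R S y z"
    and contraction: "\<And>n c d p w. n > 0 \<Longrightarrow> c \<in> A \<Longrightarrow> d \<in> A \<Longrightarrow> p \<in> fst c \<Longrightarrow> \<phi> (real n *\<^sub>R a) p \<in> fst d \<Longrightarrow>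
      w \<in> E c p \<Longrightarrow> tnorm d (\<phi> (real n *\<^sub>R a) p) (chart_deriv c d (\<phi> (real n *\<^sub>R a)) p w)
        \<le> q n * tnorm c p w"
    and bound: "\<And>v p c d w. norm v \<le> R \<Longrightarrow> c \<in> A \<Longrightarrow> d \<in> A \<Longrightarrow> p \<in> fst c \<Longrightarrow> \<phi> v p \<in> fst d \<Longrightarrow>
      tnorm d (\<phi> v p) (chart_deriv c d (\<phi> v) p w) \<le> K * tnorm c p w"
    and "K > 0" "\<And>n. q n \<ge> 0"
  obtains b where "norm b \<le> R"
    "\<And>n. n > 0 \<Longrightarrow> \<exists>\<gamma>. speed_at_most (K * (q n * S)) \<gamma> \<and>
       \<gamma> 0 = \<phi> (real n *\<^sub>R a) y \<and> \<gamma> 1 = \<phi> (real n *\<^sub>R a) (\<phi> (- b) z)"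
proof -
  obtain \<sigma> U u s where ends: "\<sigma> 0 = y" "\<sigma> 1 = z" "U 0 = 0"
    and \<sigma>: "\<And>t. t \<in> {0..1::real} \<Longrightarrow> \<sigma> t \<in> fst c"
    and U: "\<And>t. t \<in> {0..1::real} \<Longrightarrow> norm (U t) \<le> R"
    and U': "\<And>t. t \<in> {0..1::real} \<Longrightarrow> (U has_vector_derivative u t) (at t within {0..1})"
    and \<sigma>': "\<And>t. t \<in> {0..1::real} \<Longrightarrow>
      ((\<lambda>t. snd c (\<sigma> t)) has_vector_derivative generator c (\<sigma> t) (u t) + s t) (at t within {0..1})"
    and s: "\<And>t. t \<in> {0..1::real} \<Longrightarrow> s t \<in> E c (\<sigma> t)" "\<And>t. t \<in> {0..1::real} \<Longrightarrow> tnorm c (\<sigma> t) (s t) \<le> S"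
    using curve unfolding stable_curve_def by blast
  have contU: "continuous_on {0..1} U"
    using U' has_vector_derivative_continuous continuous_on_eq_continuous_within by blast
  have "continuous_on {0..1} (\<lambda>t. snd c (\<sigma> t))"
    using \<sigma>' has_vector_derivative_continuous continuous_on_eq_continuous_within by blast
  then have "continuous_on {0..1} (\<lambda>t. chart_inv c (snd c (\<sigma> t)))"
    by (rule continuous_on_compose2[OF continuous_chart_inv[OF c]]) (use \<sigma> in auto)
  then have cont\<sigma>: "continuous_on {0..1} \<sigma>"
    by (rule continuous_on_eq) (use c \<sigma> in auto)
  show thesis
  proof
    show "norm (U 1) \<le> R" using U by simp
    fix n :: nat assume "n > 0"
    define \<gamma> where "\<gamma> = (\<lambda>t. \<phi> (real n *\<^sub>R a - U t) (\<sigma> t))"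
    have "continuous_on {0..1} \<gamma>"
      unfolding \<gamma>_def by (intro continuous_on_act continuous_on_diff continuous_on_const contU cont\<sigma>)
    moreover have "\<exists>w. ((\<lambda>t. snd d (\<gamma> t)) has_vector_derivative w) (at t within {0..1}) \<and>
        tnorm d (\<gamma> t) w \<le> K * (q n * S)"
      if t: "t \<in> {0..1}" and d: "d \<in> A" "\<gamma> t \<in> fst d" for t d
    proof (intro exI conjI)
      show "((\<lambda>t. snd d (\<gamma> t)) has_vector_derivative
          chart_deriv c d (\<phi> (real n *\<^sub>R a - U t)) (\<sigma> t) (s t)) (at t within {0..1})"
        unfolding \<gamma>_def using flow_compensated_derivative[OF c d(1) \<sigma> t _ U'[OF t] \<sigma>'[OF t]] d(2)
        by (simp add: \<gamma>_def)
      obtain e where e: "e \<in> A" "\<phi> (real n *\<^sub>R a) (\<sigma> t) \<in> fst e" by (rule chart_exists)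
      have \<gamma>t: "\<gamma> t = \<phi> (- U t) (\<phi> (real n *\<^sub>R a) (\<sigma> t))"
        by (simp add: \<gamma>_def flip: act_add)
      have "chart_deriv c d (\<phi> (real n *\<^sub>R a - U t)) (\<sigma> t) (s t)
          = chart_deriv e d (\<phi> (- U t)) (\<phi> (real n *\<^sub>R a) (\<sigma> t)) (chart_deriv c e (\<phi> (real n *\<^sub>R a)) (\<sigma> t) (s t))"
        using chart_deriv_chain[OF c d(1) e(1) \<sigma>[OF t] e(2), of "- U t" "s t"] d(2) by (simp add: \<gamma>_def)
      then have "tnorm d (\<gamma> t) (chart_deriv c d (\<phi> (real n *\<^sub>R a - U t)) (\<sigma> t) (s t))
          \<le> K * tnorm e (\<phi> (real n *\<^sub>R a) (\<sigma> t)) (chart_deriv c e (\<phi> (real n *\<^sub>R a)) (\<sigma> t) (s t))"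
        using bound[of "- U t" e d "\<phi> (real n *\<^sub>R a) (\<sigma> t)"] U[OF t] d e by (simp add: \<gamma>t)
      also have "\<dots> \<le> K * (q n * tnorm c (\<sigma> t) (s t))"
        using contraction[OF \<open>n > 0\<close> c e(1) \<sigma>[OF t] e(2) s(1)[OF t]] \<open>K > 0\<close> by simp
      also have "\<dots> \<le> K * (q n * S)"
        using s(2)[OF t] \<open>K > 0\<close> \<open>q n \<ge> 0\<close> by (simp add: mult_left_mono)
      finally show "tnorm d (\<gamma> t) (chart_deriv c d (\<phi> (real n *\<^sub>R a - U t)) (\<sigma> t) (s t)) \<le> K * (q n * S)" .
    qed
    ultimately have "speed_at_most (K * (q n * S)) \<gamma>"
      by (simp add: speed_at_most_def)
    moreover have "\<gamma> 0 = \<phi> (real n *\<^sub>R a) y" "\<gamma> 1 = \<phi> (real n *\<^sub>R a) (\<phi> (- U 1) z)"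
      by (simp_all add: \<gamma>_def ends flip: act_add)
    ultimately show "\<exists>\<gamma>. speed_at_most (K * (q n * S)) \<gamma> \<and>
       \<gamma> 0 = \<phi> (real n *\<^sub>R a) y \<and> \<gamma> 1 = \<phi> (real n *\<^sub>R a) (\<phi> (- U 1) z)" by blast
  qed
qed

section \<open>Passage to the limit along the forward iterates of the Anosov element\<close>

lemma anosov_contraction:
  assumes "anosov_splitting A G \<phi> a Ess Euu"
  obtains q :: "nat \<Rightarrow> real" where "q \<longlonglongrightarrow> 0" "\<And>n. q n \<ge> 0"
    "\<And>n c d p w. n > 0 \<Longrightarrow> c \<in> A \<Longrightarrow> d \<in> A \<Longrightarrow> p \<in> fst c \<Longrightarrow> \<phi> (real n *\<^sub>R a) p \<in> fst d \<Longrightarrow>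
      w \<in> Ess c p \<Longrightarrow> tnorm d (\<phi> (real n *\<^sub>R a) p) (chart_deriv c d (\<phi> (real n *\<^sub>R a)) p w)
        \<le> q n * tnorm c p w"
proof -
  obtain l C where lC: "l > 0" "C > 0" and *: "\<forall>n::int. \<forall>c\<in>A. \<forall>d\<in>A. \<forall>p\<in>fst c.
        \<phi> (of_int n *\<^sub>R a) p \<in> fst d \<longrightarrow>
        (n > 0 \<longrightarrow> (\<forall>w\<in>Ess c p.
           tangent_norm G d (\<phi> (of_int n *\<^sub>R a) p) (chart_deriv c d (\<phi> (of_int n *\<^sub>R a)) p w)
             \<le> C * exp (- l * of_int n) * tangent_norm G c p w)) \<and>
        (n < 0 \<longrightarrow> (\<forall>w\<in>Euu c p.
           tangent_norm G d (\<phi> (of_int n *\<^sub>R a) p) (chart_deriv c d (\<phi> (of_int n *\<^sub>R a)) p w)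
             \<le> C * exp (l * of_int n) * tangent_norm G c p w))"
    using assms unfolding anosov_splitting_def by blast
  define q where "q = (\<lambda>n::nat. C * exp (- l * real n))"
  show thesis
  proof
    have "(\<lambda>n. exp (- l) ^ n) \<longlonglongrightarrow> 0"
      using lC by (intro LIMSEQ_realpow_zero) auto
    then have "(\<lambda>n. C * exp (- l) ^ n) \<longlonglongrightarrow> C * 0"
      by (rule tendsto_mult_left)
    then show "q \<longlonglongrightarrow> 0"
      by (simp add: q_def exp_of_nat_mult[symmetric] mult.commute)
    show "q n \<ge> 0" for n using lC by (simp add: q_def)
    fix n :: nat and c d p w
    assume "n > 0" "c \<in> A" "d \<in> A" "p \<in> fst c" "\<phi> (real n *\<^sub>R a) p \<in> fst d" "w \<in> Ess c p"
    then show "tnorm d (\<phi> (real n *\<^sub>R a) p) (chart_deriv c d (\<phi> (real n *\<^sub>R a)) p w)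
        \<le> q n * tnorm c p w"
      using *[THEN spec, of "int n", THEN bspec, of c, THEN bspec, of d, THEN bspec, of p]
      by (simp add: q_def)
  qed
qed

text \<open>For each \<open>n\<close> the cover is applied to
  \<open>\<phi> (- real n *\<^sub>R a) z\<close> instead of \<open>z\<close>. Carrying the resulting
  curve forward shows that \<open>z\<close> is \<open>\<phi> b\<close> of the end of a curve that
  starts at \<open>\<phi> (real n *\<^sub>R a) (y i)\<close> and has speed at most
  \<open>K * (q n * S)\<close>. As this speed tends to 0, the end point has the same limit as the
  starting point.\<close>

lemma invariant_set_in_finitely_many_orbit_pieces:
  assumes compact: "compact (UNIV :: 'm set)"
    and anosov: "anosov_splitting A G \<phi> a Ess Euu"
    and invariant: "\<And>v z. z \<in> Q \<Longrightarrow> \<phi> v z \<in> Q"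
    and "finite I" and c: "\<And>i. i \<in> I \<Longrightarrow> c i \<in> A"
    and cover: "\<And>z. z \<in> Q \<Longrightarrow> \<exists>i\<in>I. stable_curve Ess (c i) R S (y i) z"
  obtains y' where "Q \<subseteq> (\<Union>i\<in>I. (\<lambda>b. \<phi> b (y' i)) ` cball 0 R)"
proof -
  obtain q where q: "q \<longlonglongrightarrow> 0" "\<And>n. q n \<ge> 0"
    "\<And>n c d p w. n > 0 \<Longrightarrow> c \<in> A \<Longrightarrow> d \<in> A \<Longrightarrow> p \<in> fst c \<Longrightarrow> \<phi> (real n *\<^sub>R a) p \<in> fst d \<Longrightarrow>
      w \<in> Ess c p \<Longrightarrow> tnorm d (\<phi> (real n *\<^sub>R a) p) (chart_deriv c d (\<phi> (real n *\<^sub>R a)) p w)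
        \<le> q n * tnorm c p w"
    using anosov_contraction[OF anosov] by blast
  obtain K where K: "K > 0"
    "\<And>v p c d w. norm v \<le> R \<Longrightarrow> c \<in> A \<Longrightarrow> d \<in> A \<Longrightarrow> p \<in> fst c \<Longrightarrow> \<phi> v p \<in> fst d \<Longrightarrow>
      tnorm d (\<phi> v p) (chart_deriv c d (\<phi> v) p w) \<le> K * tnorm c p w"
    using act_deriv_bounded[OF compact, of R] by blast
  \<comment> \<open>The limits \<open>y' i\<close> are fixed before \<open>z\<close> is chosen, so
    they serve all points of \<open>Q\<close>; the filter may then be refined further for each
    \<open>z\<close> without changing them.\<close>
  obtain F y' where F: "F \<le> sequentially" "F \<noteq> bot"
    and y': "\<And>i. i \<in> I \<Longrightarrow> ((\<lambda>n. \<phi> (real n *\<^sub>R a) (y i)) \<longlongrightarrow> y' i) F"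
    using convergent_subfilter[OF \<open>finite I\<close> compact sequentially_bot, of "\<lambda>i n. \<phi> (real n *\<^sub>R a) (y i)"]
    by simp blast
  have "z \<in> (\<Union>i\<in>I. (\<lambda>b. \<phi> b (y' i)) ` cball 0 R)" if "z \<in> Q" for z
  proof -
    have "\<exists>i b \<gamma>. i \<in> I \<and> norm b \<le> R \<and> (n > 0 \<longrightarrow> speed_at_most (K * (q n * S)) \<gamma> \<and>
        \<gamma> 0 = \<phi> (real n *\<^sub>R a) (y i) \<and> z = \<phi> b (\<gamma> 1))" for n :: nat
    proof -
      obtain i where i: "i \<in> I" "stable_curve Ess (c i) R S (y i) (\<phi> (- real n *\<^sub>R a) z)"
        using cover[OF invariant[OF \<open>z \<in> Q\<close>]] by blast
      obtain b where b: "norm b \<le> R"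
        "\<And>m. m > 0 \<Longrightarrow> \<exists>\<gamma>. speed_at_most (K * (q m * S)) \<gamma> \<and>
          \<gamma> 0 = \<phi> (real m *\<^sub>R a) (y i) \<and> \<gamma> 1 = \<phi> (real m *\<^sub>R a) (\<phi> (- b) (\<phi> (- real n *\<^sub>R a) z))"
        using stable_curve_contracts[OF c[OF i(1)] i(2) q(3) K(2,1) q(2)] by blast
      \<comment> \<open>Commutativity of the acting group lets the shifts by \<open>b\<close> and by
        \<open>real n *\<^sub>R a\<close> cancel across each other.\<close>
      have "z = \<phi> b (\<phi> (real n *\<^sub>R a) (\<phi> (- b) (\<phi> (- real n *\<^sub>R a) z)))"
        by (simp flip: act_add)
      moreover have "\<exists>\<gamma>. n > 0 \<longrightarrow> speed_at_most (K * (q n * S)) \<gamma> \<and> \<gamma> 0 = \<phi> (real n *\<^sub>R a) (y i) \<and>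
          \<gamma> 1 = \<phi> (real n *\<^sub>R a) (\<phi> (- b) (\<phi> (- real n *\<^sub>R a) z))"
        using b(2)[of n] by (cases "n > 0") auto
      ultimately show ?thesis
        using i(1) b(1) by metis
    qed
    then obtain i b \<gamma> where i: "\<And>n. i n \<in> I" and b: "\<And>n. norm (b n) \<le> R"
      and \<gamma>: "\<And>n. n > 0 \<Longrightarrow> speed_at_most (K * (q n * S)) (\<gamma> n) \<and>
        \<gamma> n 0 = \<phi> (real n *\<^sub>R a) (y (i n)) \<and> z = \<phi> (b n) (\<gamma> n 1)"
      by metis
    obtain F1 b0 where F1: "F1 \<le> F" "F1 \<noteq> bot" "(b \<longlongrightarrow> b0) F1" "b0 \<in> cball 0 R"
      by (rule convergent_subfilter[of "{()}" "cball 0 R" F "\<lambda>_. b"]) (use F(2) b in auto)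
    \<comment> \<open>Pigeonhole along a filter: one of the finitely many indices occurs frequently,
      and restricting the filter to the times at which it occurs keeps it nontrivial.\<close>
    have "\<exists>j\<in>I. \<exists>\<^sub>F n in F1. i n = j"
    proof (rule ccontr)
      assume "\<not> (\<exists>j\<in>I. \<exists>\<^sub>F n in F1. i n = j)"
      then have "\<forall>\<^sub>F n in F1. \<forall>j\<in>I. i n \<noteq> j"
        using \<open>finite I\<close> by (simp add: eventually_ball_finite not_frequently)
      then have "\<forall>\<^sub>F n in F1. False"
        by eventually_elim (use i in blast)
      then show False using F1(2) by (simp add: trivial_limit_def)
    qed
    then obtain j where j: "j \<in> I" "\<exists>\<^sub>F n in F1. i n = j" by blast
    define F2 where "F2 = inf F1 (principal {n. i n = j})"
    have F2: "F2 \<noteq> bot" "F2 \<le> F1"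
      using j(2) by (auto simp: F2_def trivial_limit_def eventually_inf_principal frequently_def)
    have on_j: "\<forall>\<^sub>F n in F2. i n = j" by (simp add: F2_def eventually_inf_principal)
    have F2_seq: "F2 \<le> sequentially" using F2(2) F1(1) F(1) by order
    then have pos: "\<forall>\<^sub>F n in F2. n > 0"
      using eventually_gt_at_top[of 0] by (rule filter_leD)
    have lim_b: "(b \<longlongrightarrow> b0) F2" using F1(3) F2(2) by (rule tendsto_mono[rotated])
    have "((\<lambda>n. \<phi> (real n *\<^sub>R a) (y j)) \<longlongrightarrow> y' j) F2"
      using y'[OF j(1)] F2(2) F1(1) by (meson order_trans tendsto_mono)
    have "((\<lambda>n. \<gamma> n 1) \<longlongrightarrow> y' j) F2"
    proof (rule topological_tendstoI)
      fix N assume "open N" "y' j \<in> N"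
      then obtain N' \<epsilon> where N': "open N'" "y' j \<in> N'" "\<epsilon> > 0"
        "\<And>\<gamma>. speed_at_most \<epsilon> \<gamma> \<Longrightarrow> \<gamma> 0 \<in> N' \<Longrightarrow> \<gamma> 1 \<in> N"
        by (rule slow_curves_stay_near) blast
      have "(\<lambda>n. K * (q n * S)) \<longlonglongrightarrow> K * (0 * S)"
        using q(1) by (intro tendsto_intros)
      then have "\<forall>\<^sub>F n in F2. K * (q n * S) < \<epsilon>"
        using N'(3) order_tendstoD(2) filter_leD[OF F2_seq] by fastforce
      moreover have "\<forall>\<^sub>F n in F2. \<phi> (real n *\<^sub>R a) (y j) \<in> N'"
        using \<open>((\<lambda>n. \<phi> (real n *\<^sub>R a) (y j)) \<longlongrightarrow> y' j) F2\<close> N'(1,2) by (rule topological_tendstoD)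
      ultimately show "\<forall>\<^sub>F n in F2. \<gamma> n 1 \<in> N"
        using pos on_j
      proof eventually_elim
        case (elim n)
        have "speed_at_most \<epsilon> (\<gamma> n)"
          using \<gamma>[OF elim(3)] elim(1) unfolding speed_at_most_def by (meson less_imp_le order_trans)
        moreover have "\<gamma> n 0 \<in> N'" using \<gamma>[OF elim(3)] elim(2,4) by simp
        ultimately show ?case by (rule N'(4))
      qed
    qed
    with lim_b have "((\<lambda>n. \<phi> (b n) (\<gamma> n 1)) \<longlongrightarrow> \<phi> b0 (y' j)) F2" by (rule tendsto_act)
    moreover have "((\<lambda>n. \<phi> (b n) (\<gamma> n 1)) \<longlongrightarrow> z) F2"
    proof (rule tendsto_eventually)
      show "\<forall>\<^sub>F n in F2. \<phi> (b n) (\<gamma> n 1) = z"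
        using pos by eventually_elim (use \<gamma> in simp)
    qed
    ultimately have "z = \<phi> b0 (y' j)" using limit_unique[OF F2(1)] by blast
    then show ?thesis using j(1) F1(4) by blast
  qed
  then show thesis using that by blast
qed

section \<open>Frames of the weak stable bundle and stable curves inside plaques\<close>

lemma continuous_subbundle_frame:
  fixes E :: "('m, 'e) plane_field"
  assumes "continuous_subbundle A E" "c \<in> A" "p \<in> fst c"
  obtains N r and b :: "nat \<Rightarrow> 'm \<Rightarrow> 'e" where "open N" "p \<in> N" "N \<subseteq> fst c"
    "\<forall>i<r. continuous_on N (b i)"
    "\<forall>q\<in>N. inj_on (\<lambda>i. b i q) {..<r} \<and> independent ((\<lambda>i. b i q) ` {..<r}) \<and>
       span ((\<lambda>i. b i q) ` {..<r}) = E c q"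
  using assms unfolding continuous_subbundle_def
  by (elim conjE) (drule (1) bspec, drule (1) bspec, elim exE conjE, rule that)

text \<open>\<open>L q\<close> maps coefficients onto the weak stable space: the first component
  combines a local frame of \<open>Ess\<close>, the second is a group direction acting through
  \<open>generator\<close>. The uniform lower bound on \<open>W\<close> makes the coefficients of a
  bounded continuous weak stable field bounded and continuous, which is what allows its orbit
  component to be integrated.\<close>

lemma weak_stable_frame:
  assumes lf: "locally_free \<phi>" and anosov: "anosov_splitting A G \<phi> a Ess Euu"
    and c: "c \<in> A" "y \<in> fst c"
  obtains N e M W and L :: "'m \<Rightarrow> 'e \<times> (real^'k) \<Rightarrow> 'e"
  where "open N" "y \<in> N" "N \<subseteq> fst c" "e > 0" "M > 0" "subspace W"
    "\<And>q. q \<in> N \<Longrightarrow> linear (L q)" "\<And>w. continuous_on N (\<lambda>q. L q w)"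
    "\<And>q x u. q \<in> N \<Longrightarrow> L q (x, u) = L q (x, 0) + generator c q u"
    "\<And>q x. q \<in> N \<Longrightarrow> L q (x, 0) \<in> Ess c q"
    "\<And>q. q \<in> N \<Longrightarrow> weak_stable_field \<phi> Ess c q \<subseteq> L q ` W"
    "\<And>q w. q \<in> N \<Longrightarrow> w \<in> W \<Longrightarrow> e * norm w \<le> norm (L q w)"
    "\<And>q w. q \<in> N \<Longrightarrow> norm (L q w) \<le> M * norm w"
proof -
  have bundles: "continuous_subbundle A Ess" "continuous_subbundle A Euu"
    using anosov by (simp_all add: anosov_splitting_def)
  obtain N0 and r :: nat and b where N0: "open N0" "y \<in> N0" "N0 \<subseteq> fst c"
    and b: "\<forall>i<r. continuous_on N0 (b i)"
    and "\<forall>q\<in>N0. inj_on (\<lambda>i. b i q) {..<r} \<and> independent ((\<lambda>i. b i q) ` {..<r}) \<and>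
       span ((\<lambda>i. b i q) ` {..<r}) = Ess c q"
    by (fact continuous_subbundle_frame[OF bundles(1) c])
  then have frame: "\<And>q. q \<in> N0 \<Longrightarrow> inj_on (\<lambda>i. b i q) {..<r}"
      "\<And>q. q \<in> N0 \<Longrightarrow> independent ((\<lambda>i. b i q) ` {..<r})"
      "\<And>q. q \<in> N0 \<Longrightarrow> span ((\<lambda>i. b i q) ` {..<r}) = Ess c q"
    by blast+
  \<comment> \<open>Directness of the splitting is stated for all three summands at once; to use it
    for the first two, the third is filled with 0, which lies in the fibre because a fibre is a
    span.\<close>
  have zero_Euu: "0 \<in> Euu c y"
    by (rule continuous_subbundle_frame[OF bundles(2) c]) (metis span_zero)
  have direct: "x = 0 \<and> u = 0" if "x \<in> Ess c y" "x + generator c y u = 0" for x u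
  proof -
    have "generator c y u \<in> orbit_tangent \<phi> c y" by (simp add: orbit_tangent_eq)
    moreover have "x + generator c y u + 0 = 0" using that(2) by simp
    ultimately have "x = 0 \<and> generator c y u = 0"
      using anosov c that(1) zero_Euu unfolding anosov_splitting_def by blast
    then show ?thesis using inj_generator[OF lf c] by blast
  qed
  have "r = card ((\<lambda>i. b i y) ` {..<r})" using frame(1)[OF N0(2)] by (simp add: card_image)
  also have "\<dots> \<le> DIM('e)" using frame(2)[OF N0(2)] independent_bound by blast
  finally have "card {..<r} \<le> card (Basis :: 'e set)" by simp
  then obtain \<beta> where \<beta>: "\<beta> ` {..<r} \<subseteq> (Basis :: 'e set)" "inj_on \<beta> {..<r}"
    using card_le_inj[of "{..<r}" "Basis :: 'e set"] by auto
  \<comment> \<open>The rank \<open>r\<close> is not a type, so the coefficients of the frame are stored as coordinates of a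
    vector of \<open>'e\<close>, of which only those along \<open>\<beta> ` {..<r}\<close> are used.\<close>
  define L where "L = (\<lambda>q (w :: 'e \<times> (real^'k)). (\<Sum>i<r. (fst w \<bullet> \<beta> i) *\<^sub>R b i q) + generator c q (snd w))"
  define W where "W = {w :: 'e \<times> (real^'k). \<forall>j\<in>Basis - \<beta> ` {..<r}. fst w \<bullet> j = 0}"
  have "subspace W"
    by (auto simp: W_def subspace_def inner_add_left)
  have lin: "linear (L q)" if "q \<in> N0" for q
    using linear_add[OF linear_generator[OF c(1)]] linear_scale[OF linear_generator[OF c(1)]] that N0
    by (auto simp: L_def linear_iff inner_add_left scaleR_add_left sum.distrib scaleR_add_right scaleR_sum_right subset_iff)
  have cont: "continuous_on N0 (\<lambda>q. L q w)" for w
    unfolding L_def using continuous_on_subset[OF continuous_generator[OF c(1)] N0(3)] b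
    by (intro continuous_on_add continuous_on_sum continuous_on_scaleR continuous_on_const) auto
  have split: "L q (x, u) = L q (x, 0) + generator c q u" if "q \<in> N0" for q x u
    using linear_0[OF linear_generator[OF c(1)], of q] that N0 by (auto simp: L_def)
  have L0: "L q (x, 0) = (\<Sum>i<r. (x \<bullet> \<beta> i) *\<^sub>R b i q)" if "q \<in> N0" for q x
    using linear_0[OF linear_generator[OF c(1)], of q] that N0 by (auto simp: L_def)
  have in_Ess: "L q (x, 0) \<in> Ess c q" if "q \<in> N0" for q x
  proof -
    have "(\<Sum>i<r. (x \<bullet> \<beta> i) *\<^sub>R b i q) \<in> span ((\<lambda>i. b i q) ` {..<r})"
      by (intro span_sum span_scale span_base) auto
    then show ?thesis using L0[OF that] frame(3)[OF that] by simp
  qed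
  have onto: "weak_stable_field \<phi> Ess c q \<subseteq> L q ` W" if q: "q \<in> N0" for q
  proof
    fix w assume "w \<in> weak_stable_field \<phi> Ess c q"
    then obtain s u where w: "w = generator c q u + s" and s: "s \<in> Ess c q"
      by (auto simp: weak_stable_field_def orbit_tangent_eq)
    have "s \<in> span ((\<lambda>i. b i q) ` {..<r})" using s frame(3)[OF q] by simp
    then obtain k where "s = (\<Sum>v\<in>(\<lambda>i. b i q) ` {..<r}. k v *\<^sub>R v)"
      by (auto simp: span_finite)
    then have s_eq: "s = (\<Sum>i<r. k (b i q) *\<^sub>R b i q)"
      using frame(1)[OF q] by (simp add: sum.reindex)
    define x where "x = (\<Sum>i<r. k (b i q) *\<^sub>R \<beta> i)"
    have "x \<bullet> \<beta> j = k (b j q)" if "j < r" for j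
    proof -
      have "x \<bullet> \<beta> j = (\<Sum>i<r. k (b i q) * (\<beta> i \<bullet> \<beta> j))"
        by (simp add: x_def inner_sum_left)
      also have "\<dots> = (\<Sum>i<r. if i = j then k (b j q) else 0)"
        using \<beta> that by (intro sum.cong) (auto simp: inner_Basis inj_on_def image_subset_iff)
      finally show ?thesis using that by simp
    qed
    moreover have "x \<bullet> j = 0" if "j \<in> Basis - \<beta> ` {..<r}" for j
      using that \<beta>(1) by (auto simp: x_def inner_sum_left inner_Basis image_subset_iff intro!: sum.neutral)
    ultimately have "L q (x, 0) = s" "(x, u) \<in> W"
      using L0[OF q] s_eq by (auto simp: W_def)
    then show "w \<in> L q ` W"
      using split[OF q, of x u] w by (auto simp: image_iff add.commute intro!: bexI[of _ "(x, u)"])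
  qed
  have inj: "w = 0" if w: "w \<in> W" "L y w = 0" for w
  proof -
    obtain x u where xu: "w = (x, u)" by (cases w)
    have "L y (x, 0) = 0" "u = 0"
      using direct[OF in_Ess[OF N0(2), of x], of u] split[OF N0(2), of x u] w(2) xu by auto
    have fr: "inj_on (\<lambda>i. b i y) {..<r}" "independent ((\<lambda>i. b i y) ` {..<r})"
      using frame(1,2)[OF N0(2)] by auto
    have inv: "inv_into {..<r} (\<lambda>i. b i y) (b i y) = i" if "i < r" for i
      using inv_into_f_f[OF fr(1), of i] that by simp
    have "(\<Sum>v\<in>(\<lambda>i. b i y) ` {..<r}. (x \<bullet> \<beta> (inv_into {..<r} (\<lambda>i. b i y) v)) *\<^sub>R v) = L y (x, 0)"
      using fr(1) inv by (simp add: sum.reindex L0[OF N0(2)])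
    then have coeff: "x \<bullet> \<beta> (inv_into {..<r} (\<lambda>i. b i y) v) = 0" if "v \<in> (\<lambda>i. b i y) ` {..<r}" for v
      using independentD[OF fr(2), of "(\<lambda>i. b i y) ` {..<r}"
          "\<lambda>v. x \<bullet> \<beta> (inv_into {..<r} (\<lambda>i. b i y) v)" v] that \<open>L y (x, 0) = 0\<close> by simp
    have "x \<bullet> \<beta> i = 0" if "i < r" for i
      using coeff[of "b i y"] inv[OF that] that by simp
    moreover have "x \<bullet> j = 0" if "j \<in> Basis - \<beta> ` {..<r}" for j
      using w(1) that by (simp add: xu W_def)
    ultimately have "x \<bullet> j = 0" if "j \<in> Basis" for j
      using that by (cases "j \<in> \<beta> ` {..<r}") auto
    then have "x = 0" by (simp add: euclidean_eq_iff[where 'a='e])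
    then show ?thesis using \<open>u = 0\<close> xu by (simp add: zero_prod_def)
  qed
  obtain N1 e where N1: "open N1" "y \<in> N1" "N1 \<subseteq> N0" "e > 0"
    "\<And>q w. q \<in> N1 \<Longrightarrow> w \<in> W \<Longrightarrow> e * norm w \<le> norm (L q w)"
    using linear_family_bounded_below[OF N0(1,2) lin cont \<open>subspace W\<close> inj] by blast
  obtain N2 M where N2: "open N2" "y \<in> N2" "N2 \<subseteq> N0" "M > 0"
    "\<And>q w. q \<in> N2 \<Longrightarrow> norm (L q w) \<le> M * norm w"
    using linear_family_bounded_above[OF N0(1,2) lin cont] by blast
  have "continuous_on (N1 \<inter> N2) (\<lambda>q. L q w)" for w
    using cont N1(3) by (blast intro: continuous_on_subset)
  with N0 N1 N2 \<open>subspace W\<close> lin split in_Ess onto show thesis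
    by (intro that[of "N1 \<inter> N2" e M W L]) blast+
qed

text \<open>The curve is the straight segment from \<open>y\<close> to \<open>z\<close> in plaque
  coordinates. Its velocity is weak stable because plaques are tangent to the weak stable field; its
  \<open>L\<close>-coefficients give the stable part \<open>s\<close> and the group direction
  \<open>u\<close>, and \<open>U\<close> is the integral of \<open>u\<close>. Bounding the segment
  by \<open>\<rho>\<close> makes \<open>R\<close> and \<open>S\<close> independent of
  \<open>z\<close>.\<close>

lemma plaque_stable_curves:
  fixes F :: "('m, 'b::euclidean_space) foliated_chart set"
  assumes lf: "locally_free \<phi>" and anosov: "anosov_splitting A G \<phi> a Ess Euu"
    and fol: "tangent_foliation A (weak_stable_field \<phi> Ess) F"
    and f: "f \<in> F" "y \<in> fst f"
  obtains V c R S where "open V" "y \<in> V" "c \<in> A"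
    "\<And>z. z \<in> V \<Longrightarrow> z \<in> fst f \<Longrightarrow> transverse f z = transverse f y \<Longrightarrow> stable_curve Ess c R S y z"
proof -
  obtain c where c: "c \<in> A" "y \<in> fst c" by (rule chart_exists)
  obtain N e M W and L :: "'m \<Rightarrow> 'e \<times> (real^'k) \<Rightarrow> 'e" where N: "open N" "y \<in> N" "N \<subseteq> fst c" and eM: "e > 0" "M > 0" and W: "subspace W"
    and L: "\<And>q. q \<in> N \<Longrightarrow> linear (L q)" "\<And>w. continuous_on N (\<lambda>q. L q w)"
    "\<And>q x u. q \<in> N \<Longrightarrow> L q (x, u) = L q (x, 0) + generator c q u"
    "\<And>q x. q \<in> N \<Longrightarrow> L q (x, 0) \<in> Ess c q"
    "\<And>q. q \<in> N \<Longrightarrow> weak_stable_field \<phi> Ess c q \<subseteq> L q ` W"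
    "\<And>q w. q \<in> N \<Longrightarrow> w \<in> W \<Longrightarrow> e * norm w \<le> norm (L q w)"
    "\<And>q w. q \<in> N \<Longrightarrow> norm (L q w) \<le> M * norm w"
    by (fact weak_stable_frame[OF lf anosov c])
  have atlas: "foliation_atlas F" using fol by (simp add: tangent_foliation_def)
  obtain P I where PI: "open P" "open I" "homeomorphism (fst f) (P \<times> I) (snd f) (chart_inv f)"
    and open_f: "open (fst f)"
    using atlas f(1) unfolding foliation_atlas_def by blast
  have f_simps: "\<And>p. p \<in> fst f \<Longrightarrow> snd f p \<in> P \<times> I" "\<And>p. p \<in> fst f \<Longrightarrow> chart_inv f (snd f p) = p"
    "\<And>z. z \<in> P \<times> I \<Longrightarrow> snd f (chart_inv f z) = z" "\<And>z. z \<in> P \<times> I \<Longrightarrow> chart_inv f z \<in> fst f"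
    using homeomorphism_image1[OF PI(3)] homeomorphism_apply1[OF PI(3)] homeomorphism_apply2[OF PI(3)]
      homeomorphism_image2[OF PI(3)] by blast+
  have f_cont: "continuous_on (fst f) (snd f)" "continuous_on (P \<times> I) (chart_inv f)"
    using homeomorphism_cont1[OF PI(3)] homeomorphism_cont2[OF PI(3)] .
  obtain D where D_cont: "\<And>h. continuous_on (fst f \<inter> fst c) (\<lambda>p. D p h)"
    and D: "\<And>p. p \<in> fst f \<inter> fst c \<Longrightarrow>
        ((\<lambda>u. snd c (chart_inv f (u, transverse f p))) has_derivative D p) (at (fst (snd f p)))"
    "\<And>p. p \<in> fst f \<inter> fst c \<Longrightarrow> range (D p) = weak_stable_field \<phi> Ess c p"
    using fol f(1) c(1) unfolding tangent_foliation_def by metis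
  have D_lin: "linear (D p)" if "p \<in> fst f \<inter> fst c" for p
    using D(1)[OF that] has_derivative_linear by blast
  have fc: "open (fst f \<inter> fst c)" "y \<in> fst f \<inter> fst c" using open_Int[OF open_f open_chart[OF c(1)]] c f by auto
  obtain N1 B where N1: "open N1" "y \<in> N1" "N1 \<subseteq> fst f \<inter> fst c" "B > 0"
    "\<And>q h. q \<in> N1 \<Longrightarrow> norm (D q h) \<le> B * norm h"
    using linear_family_bounded_above[OF fc D_lin D_cont] by blast
  obtain N2 a' b where N2: "open N2" "y \<in> N2" "N2 \<subseteq> fst c" "b > 0"
    "\<And>q w. q \<in> N2 \<Longrightarrow> tnorm c q w \<le> b * norm w"
    using tnorm_comparable[OF c] by metis
  define y0 where "y0 = fst (snd f y)"
  define \<tau> where "\<tau> = transverse f y"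
  have y: "snd f y = (y0, \<tau>)" by (simp add: y0_def \<tau>_def)
  have "open ((P \<times> I) \<inter> chart_inv f -` (N \<inter> N1 \<inter> N2))"
    using PI N(1) N1(1) N2(1) f_cont(2) by (intro continuous_open_preimage open_Times open_Int)
  moreover have "(y0, \<tau>) \<in> (P \<times> I) \<inter> chart_inv f -` (N \<inter> N1 \<inter> N2)"
    using f_simps(1,2)[OF f(2)] N(2) N1(2) N2(2) by (simp add: y)
  ultimately obtain A1 B1 where AB: "open A1" "y0 \<in> A1" "\<tau> \<in> B1"
    "A1 \<times> B1 \<subseteq> (P \<times> I) \<inter> chart_inv f -` (N \<inter> N1 \<inter> N2)"
    by (rule open_prod_elim) auto
  obtain \<rho> where \<rho>: "\<rho> > 0" "ball y0 \<rho> \<subseteq> A1" using AB(1,2) by (rule openE)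
  have box: "(u, \<tau>) \<in> P \<times> I \<and> chart_inv f (u, \<tau>) \<in> N \<inter> N1 \<inter> N2" if "u \<in> ball y0 \<rho>" for u
    using that \<rho>(2) AB(3,4) by blast
  \<comment> \<open>Only the plaque coordinate is restricted: the transverse coordinate of
    \<open>z\<close> is prescribed by the hypothesis of the conclusion, and \<open>box\<close>
    concerns that single level.\<close>
  define V where "V = fst f \<inter> (\<lambda>z. fst (snd f z)) -` ball y0 \<rho>"
  \<comment> \<open>The coefficients satisfy \<open>e * norm (\<xi> t) \<le> norm (D (\<sigma> t) h)
    \<le> B * \<rho>\<close>.\<close>
  define R where "R = B * \<rho> / e"
  show thesis
  proof
    show "open V"
      unfolding V_def using f_cont(1) open_f by (intro continuous_open_preimage continuous_on_fst open_ball)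
    show "y \<in> V" using f \<rho> by (simp add: V_def y0_def)
    show "c \<in> A" by (rule c)
    fix z assume zV: "z \<in> V" and zf: "z \<in> fst f" and z\<tau>: "transverse f z = transverse f y"
    define h where "h = fst (snd f z) - y0"
    define \<sigma> where "\<sigma> = (\<lambda>t. chart_inv f (y0 + t *\<^sub>R h, \<tau>))"
    have h: "norm h < \<rho>" using zV by (simp add: V_def h_def dist_norm norm_minus_commute)
    have line: "y0 + t *\<^sub>R h \<in> ball y0 \<rho>" if "t \<in> {0..1}" for t
    proof -
      have "norm (t *\<^sub>R h) \<le> norm h" using that by (simp add: mult_left_le_one_le)
      then show ?thesis using h by (simp add: dist_norm)
    qed
    have \<sigma>: "\<sigma> t \<in> N \<inter> N1 \<inter> N2" "snd f (\<sigma> t) = (y0 + t *\<^sub>R h, \<tau>)" if "t \<in> {0..1}" for t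
      using box[OF line[OF that]] f_simps(3) by (auto simp: \<sigma>_def)
    have \<sigma>_in: "\<sigma> t \<in> fst f \<inter> fst c" if "t \<in> {0..1}" for t using \<sigma>(1)[OF that] N1(3) by blast
    have \<sigma>0: "\<sigma> 0 = y" using f_simps(2)[OF f(2)] by (simp add: \<sigma>_def y)
    have \<sigma>1: "\<sigma> 1 = z"
    proof -
      have "(y0 + 1 *\<^sub>R h, \<tau>) = snd f z" by (simp add: h_def \<tau>_def prod_eq_iff z\<tau>)
      then show ?thesis using f_simps(2)[OF zf] by (simp add: \<sigma>_def)
    qed
    have \<sigma>_cont: "continuous_on {0..1} \<sigma>"
      unfolding \<sigma>_def
    proof (rule continuous_on_compose2[OF f_cont(2)])
      show "continuous_on {0..1} (\<lambda>t. (y0 + t *\<^sub>R h, \<tau>))" by (intro continuous_intros)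
      show "(\<lambda>t. (y0 + t *\<^sub>R h, \<tau>)) ` {0..1} \<subseteq> P \<times> I" using box[OF line] by blast
    qed
    have \<sigma>': "((\<lambda>t. snd c (\<sigma> t)) has_vector_derivative D (\<sigma> t) h) (at t within {0..1})"
      if t: "t \<in> {0..1}" for t
    proof -
      have "((\<lambda>t. y0 + t *\<^sub>R h) has_vector_derivative h) (at t)"
        by (auto intro!: derivative_eq_intros)
      moreover have "((\<lambda>u. snd c (chart_inv f (u, \<tau>))) has_derivative D (\<sigma> t)) (at (y0 + t *\<^sub>R h))"
        using D(1)[OF \<sigma>_in[OF t]] unfolding \<sigma>(2)[OF t] fst_conv snd_conv .
      then have "((\<lambda>u. snd c (chart_inv f (u, \<tau>))) has_derivative D (\<sigma> t))
          (at (y0 + t *\<^sub>R h) within range (\<lambda>t. y0 + t *\<^sub>R h))"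
        by (rule has_derivative_at_withinI)
      ultimately have "((\<lambda>u. snd c (chart_inv f (u, \<tau>))) \<circ> (\<lambda>t. y0 + t *\<^sub>R h) has_vector_derivative D (\<sigma> t) h) (at t)"
        by (rule vector_derivative_diff_chain_within)
      then show ?thesis
        by (auto simp: \<sigma>_def o_def intro: has_vector_derivative_at_within)
    qed
    have "\<exists>w\<in>W. L (\<sigma> t) w = D (\<sigma> t) h" if "t \<in> {0..1}" for t
    proof -
      have "D (\<sigma> t) h \<in> weak_stable_field \<phi> Ess c (\<sigma> t)" using D(2)[OF \<sigma>_in[OF that]] by blast
      then have "D (\<sigma> t) h \<in> L (\<sigma> t) ` W" using L(5)[of "\<sigma> t"] \<sigma>(1)[OF that] by blast
      then show ?thesis by (metis imageE)
    qed
    then obtain \<xi> where \<xi>: "\<And>t. t \<in> {0..1} \<Longrightarrow> \<xi> t \<in> W" "\<And>t. t \<in> {0..1} \<Longrightarrow> L (\<sigma> t) (\<xi> t) = D (\<sigma> t) h"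
      by metis
    have \<xi>_bound: "norm (\<xi> t) \<le> R" if t: "t \<in> {0..1}" for t
    proof -
      have "e * norm (\<xi> t) \<le> norm (D (\<sigma> t) h)" using L(6)[of "\<sigma> t" "\<xi> t"] \<sigma>(1)[OF t] \<xi>[OF t] by simp
      also have "\<dots> \<le> B * norm h" using N1(5) \<sigma>(1)[OF t] by blast
      also have "\<dots> \<le> B * \<rho>" using N1(4) h by simp
      finally show ?thesis using eM(1) by (simp add: R_def field_simps)
    qed
    have L_cont: "continuous_on {0..1} (\<lambda>t. L (\<sigma> t) w)" for w
      by (rule continuous_on_compose2[OF L(2) \<sigma>_cont]) (use \<sigma>(1) in blast)
    have "continuous_on {0..1} (\<lambda>t. D (\<sigma> t) h)"
      by (rule continuous_on_compose2[OF D_cont \<sigma>_cont]) (use \<sigma>_in in blast)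
    then have rest_cont: "continuous_on {0..1} (\<lambda>t. D (\<sigma> t) h - L (\<sigma> t) w)" for w
      using L_cont by (rule continuous_on_diff)
    \<comment> \<open>The \<open>\<xi> t\<close> were chosen separately for each \<open>t\<close>;
      continuity comes from the lower bound. The difference \<open>\<xi> t - \<xi> t0\<close> lies
      in \<open>W\<close>, and \<open>L (\<sigma> t)\<close> maps it to
      \<open>D (\<sigma> t) h - L (\<sigma> t) (\<xi> t0)\<close>, which is continuous in
      \<open>t\<close> and vanishes at \<open>t0\<close>.\<close>
    have \<xi>_cont: "continuous_on {0..1} \<xi>"
      unfolding continuous_on_def
    proof
      fix t0 :: real assume t0: "t0 \<in> {0..1}"
      have "((\<lambda>t. D (\<sigma> t) h - L (\<sigma> t) (\<xi> t0)) \<longlongrightarrow> 0) (at t0 within {0..1})"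
        using rest_cont[of "\<xi> t0"] t0 \<xi>(2)[OF t0] unfolding continuous_on_def by force
      then have lim: "((\<lambda>t. norm (D (\<sigma> t) h - L (\<sigma> t) (\<xi> t0)) / e) \<longlongrightarrow> 0) (at t0 within {0..1})"
        by (intro tendsto_divide_zero tendsto_norm_zero)
      have "\<forall>\<^sub>F t in at t0 within {0..1}. norm (\<xi> t - \<xi> t0) \<le> norm (D (\<sigma> t) h - L (\<sigma> t) (\<xi> t0)) / e"
        unfolding eventually_at_filter
      proof (intro always_eventually allI impI)
        fix t :: real assume t: "t \<in> {0..1}"
        have "e * norm (\<xi> t - \<xi> t0) \<le> norm (L (\<sigma> t) (\<xi> t - \<xi> t0))"
          using \<sigma>(1)[OF t] subspace_diff[OF W \<xi>(1)[OF t] \<xi>(1)[OF t0]] by (intro L(6)) auto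
        also have "L (\<sigma> t) (\<xi> t - \<xi> t0) = D (\<sigma> t) h - L (\<sigma> t) (\<xi> t0)"
          using linear_diff[OF L(1)] \<sigma>(1)[OF t] \<xi>(2)[OF t] by simp
        finally show "norm (\<xi> t - \<xi> t0) \<le> norm (D (\<sigma> t) h - L (\<sigma> t) (\<xi> t0)) / e"
          using eM(1) by (simp add: field_simps)
      qed
      then have "((\<lambda>t. \<xi> t - \<xi> t0) \<longlongrightarrow> 0) (at t0 within {0..1})"
        using lim by (rule Lim_null_comparison)
      then show "(\<xi> \<longlongrightarrow> \<xi> t0) (at t0 within {0..1})" by (simp add: LIM_zero_iff)
    qed
    define u where "u = (\<lambda>t. snd (\<xi> t))"
    define s where "s = (\<lambda>t. L (\<sigma> t) (fst (\<xi> t), 0))"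
    define U where "U = (\<lambda>t. integral {0..t} u)"
    have u_cont: "continuous_on {0..1} u" unfolding u_def using \<xi>_cont by (rule continuous_on_snd)
    have u_bound: "norm (u t) \<le> R" if "t \<in> {0..1}" for t
      using \<xi>_bound[OF that] norm_snd_le[where x="fst (\<xi> t)" and y="snd (\<xi> t)"] by (auto simp: u_def intro: order_trans)
    show "stable_curve Ess c R (b * (M * R)) y z"
      unfolding stable_curve_def
    proof (intro exI conjI ballI)
      show "\<sigma> 0 = y" "\<sigma> 1 = z" "U 0 = 0" using \<sigma>0 \<sigma>1 by (auto simp: U_def)
      fix t :: real assume t: "t \<in> {0..1}"
      show "\<sigma> t \<in> fst c" using \<sigma>_in[OF t] by blast
      have "0 \<le> R" using u_bound[OF t] norm_ge_zero[of "u t"] by linarith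
      have "norm (U t) \<le> R * (t - 0)"
        unfolding U_def using t u_bound continuous_on_subset[OF u_cont]
        by (intro integral_bound) auto
      also have "\<dots> \<le> R" using t \<open>0 \<le> R\<close> by (simp add: mult_left_le)
      finally show "norm (U t) \<le> R" .
      show "(U has_vector_derivative u t) (at t within {0..1})"
        unfolding U_def using u_cont t by (rule integral_has_vector_derivative)
      have \<sigma>N: "\<sigma> t \<in> N" "\<sigma> t \<in> N2" using \<sigma>(1)[OF t] by auto
      have "D (\<sigma> t) h = generator c (\<sigma> t) (u t) + s t"
        using \<xi>(2)[OF t] L(3)[OF \<sigma>N(1), of "fst (\<xi> t)" "snd (\<xi> t)"] by (simp add: u_def s_def)
      then show "((\<lambda>t. snd c (\<sigma> t)) has_vector_derivative generator c (\<sigma> t) (u t) + s t) (at t within {0..1})"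
        using \<sigma>'[OF t] by simp
      show "s t \<in> Ess c (\<sigma> t)" using L(4)[OF \<sigma>N(1)] by (simp add: s_def)
      have "tnorm c (\<sigma> t) (s t) \<le> b * norm (s t)" by (rule N2(5)[OF \<sigma>N(2)])
      also have "norm (s t) \<le> M * norm (fst (\<xi> t), 0 :: real^'k)"
        unfolding s_def by (rule L(7)[OF \<sigma>N(1)])
      also have "norm (fst (\<xi> t), 0 :: real^'k) \<le> R"
        using \<xi>_bound[OF t] norm_fst_le[where x="fst (\<xi> t)" and y="snd (\<xi> t)"] by (auto simp: norm_Pair intro: order_trans)
      finally show "tnorm c (\<sigma> t) (s t) \<le> b * (M * R)"
        using eM N2(4) by (simp add: mult_left_mono)
    qed
  qed
qed

end

section \<open>Holonomy of nearby loops\<close>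

text \<open>Since the foliation is only continuous in the transverse direction, a curve whose velocity is
  tangent to the leaves might a priori leave its leaf. For loops inside an orbit, staying in the
  leaf is instead read off from the existence of their holonomy.\<close>
definition tangent_path :: "('p::topological_space, 'b::euclidean_space) foliated_chart set \<Rightarrow>
    (real \<Rightarrow> 'p) \<Rightarrow> real \<Rightarrow> bool" where
  "tangent_path F \<gamma> s \<longleftrightarrow> (\<forall>r0\<in>{0..s}. \<forall>d\<in>F. \<gamma> r0 \<in> fst d \<longrightarrow>
     (\<forall>\<^sub>F r in at r0 within {0..s}. transverse d (\<gamma> r) = transverse d (\<gamma> r0)))"

lemma eventually_at_outside_closed:
  assumes "closed S" "x \<notin> S"
  shows "eventually P (at x within S)"
  unfolding eventually_at_topological
  using assms by (intro exI[of _ "- S"]) auto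

text \<open>Each slide keeps the path on a level of the current chart \<open>c\<close>, while
  \<open>tangent_path\<close> asks about every chart \<open>d\<close>. Compatibility of foliated
  charts bridges the two: near a common point, \<open>transverse d\<close> is a function of
  \<open>transverse c\<close>.\<close>

lemma holonomy_tangent_path:
  assumes F: "foliation_atlas F" and \<gamma>: "continuous_on UNIV \<gamma>"
    and "holonomy F \<gamma> c0 c s h"
  shows "0 \<le> s \<and> c \<in> F \<and> \<gamma> s \<in> fst c \<and> tangent_path F \<gamma> s"
  using assms(3)
proof (induction rule: holonomy.induct)
  case start
  then show ?case by (auto simp: tangent_path_def eventually_at_filter)
next
  case (slide c s h s')
  then have s: "0 \<le> s" and c: "c \<in> F" by auto
  have "\<forall>\<^sub>F r in at r0 within {0..s'}. transverse d (\<gamma> r) = transverse d (\<gamma> r0)"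
    if r0: "r0 \<in> {0..s'}" and d: "d \<in> F" "\<gamma> r0 \<in> fst d" for r0 d
  proof -
    let ?P = "\<lambda>r. transverse d (\<gamma> r) = transverse d (\<gamma> r0)"
    have "eventually ?P (at r0 within {0..s})"
    proof (cases "r0 \<le> s")
      case True
      then show ?thesis using slide.IH r0 d by (auto simp: tangent_path_def)
    next
      case False
      then show ?thesis by (intro eventually_at_outside_closed) auto
    qed
    moreover have "eventually ?P (at r0 within {s..s'})"
    proof (cases "s \<le> r0")
      case True
      then have r0_in: "r0 \<in> {s..s'}" using r0 by auto
      then obtain N \<beta> where N: "open N" "\<gamma> r0 \<in> N" "\<And>q. q \<in> N \<Longrightarrow> transverse d q = \<beta> (transverse c q)"
        using F c d slide.hyps(3)[OF r0_in] unfolding foliation_atlas_def by (metis IntI)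
      have "open (\<gamma> -` N)" using N(1) \<gamma> by (rule open_vimage)
      then have "\<forall>\<^sub>F r in at r0 within {s..s'}. r \<in> \<gamma> -` N"
        unfolding eventually_at_topological using N(2) by (intro exI[of _ "\<gamma> -` N"]) auto
      moreover have "\<forall>\<^sub>F r in at r0 within {s..s'}. r \<in> {s..s'}"
        by (simp add: eventually_at_filter)
      ultimately show ?thesis
      proof eventually_elim
        case (elim r)
        then show ?case
          using N(3)[of "\<gamma> r"] N(3)[OF N(2)] slide.hyps(3)[of r] slide.hyps(3)[OF r0_in] by simp
      qed
    next
      case False
      then show ?thesis by (intro eventually_at_outside_closed) auto
    qed
    \<comment> \<open>At the junction \<open>r0 = s\<close> both sides are genuine one-sided
      statements; elsewhere one of the two is vacuous.\<close>
    moreover have "{0..s'} = {0..s} \<union> {s..s'}" using s slide.hyps(2) by auto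
    ultimately show ?thesis
      unfolding eventually_at_filter by eventually_elim auto
  qed
  then show ?case
    using s c slide.hyps(2) slide.hyps(3)[of s'] by (auto simp: tangent_path_def)
next
  case (change c s h d N \<beta>)
  then show ?case by auto
qed

text \<open>The chain of plaques that continues the holonomy of \<open>\<Gamma> y\<close> also
  serves nearby paths. Tangency is a premise under the quantifier over \<open>z\<close>, since a
  nearby path need not stay in a leaf. The bound \<open>s \<le> 1\<close> keeps the chain inside the
  interval on which tangency is assumed.\<close>

lemma holonomy_nearby:
  fixes F :: "('p::topological_space, 'b::euclidean_space) foliated_chart set"
  assumes F: "foliation_atlas F" and \<Gamma>: "continuous_on UNIV (\<lambda>(z, r). \<Gamma> z r)"
    and "holonomy F (\<Gamma> y) c0 c s h" and "s \<le> 1"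
  shows "\<forall>\<^sub>F z in nhds y. tangent_path F (\<Gamma> z) 1 \<longrightarrow>
    \<Gamma> z s \<in> fst c \<and> transverse c (\<Gamma> z s) = h (transverse c0 (\<Gamma> z 0))"
proof -
  have cont_z: "continuous_on UNIV (\<lambda>z. \<Gamma> z r)" for r
    using continuous_on_compose2[OF \<Gamma>, of UNIV "\<lambda>z. (z, r)"]
    by (simp add: continuous_on_Pair continuous_on_const continuous_on_id)
  have cont_r: "continuous_on UNIV (\<Gamma> z)" for z
    using continuous_on_compose2[OF \<Gamma>, of UNIV "\<lambda>r. (z, r)"]
    by (simp add: continuous_on_Pair continuous_on_const continuous_on_id)
  have open_charts: "open (fst c)" if "c \<in> F" for c
    using F that by (auto simp: foliation_atlas_def)
  have near: "\<forall>\<^sub>F z in nhds y. \<Gamma> z r \<in> N" if "open N" "\<Gamma> y r \<in> N" for r N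
    using open_vimage[OF that(1) cont_z] that(2) eventually_nhds_in_open[of "(\<lambda>z. \<Gamma> z r) -` N" y] by auto
  show ?thesis
    using assms(3,4)
  proof (induction rule: holonomy.induct)
    case start
    have "\<forall>\<^sub>F z in nhds y. \<Gamma> z 0 \<in> fst c0" using start open_charts by (intro near) auto
    then show ?case by eventually_elim simp
  next
    case (slide c s h s')
    have c: "c \<in> F" "0 \<le> s"
      using holonomy_tangent_path[OF F cont_r slide.hyps(1)] by auto
    have "open ((\<lambda>(z, r). \<Gamma> z r) -` fst c)"
      using open_charts[OF c(1)] \<Gamma> by (rule open_vimage)
    moreover have "{y} \<times> {s..s'} \<subseteq> (\<lambda>(z, r). \<Gamma> z r) -` fst c"
      using slide.hyps(3) by auto
    \<comment> \<open>The tube lemma gives one neighbourhood of \<open>y\<close> that works for the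
      whole time interval of the slide.\<close>
    ultimately have "\<exists>X0. y \<in> X0 \<and> open X0 \<and> X0 \<times> {s..s'} \<subseteq> (\<lambda>(z, r). \<Gamma> z r) -` fst c"
      by (rule Elementary_Topology.tube_lemma[OF compact_Icc])
    then obtain X0 where "y \<in> X0" "open X0" "X0 \<times> {s..s'} \<subseteq> (\<lambda>(z, r). \<Gamma> z r) -` fst c"
      by blast
    then have "\<forall>\<^sub>F z in nhds y. \<forall>r\<in>{s..s'}. \<Gamma> z r \<in> fst c"
      unfolding eventually_nhds by (intro exI[of _ X0]) auto
    moreover have "\<forall>\<^sub>F z in nhds y. tangent_path F (\<Gamma> z) 1 \<longrightarrow>
        \<Gamma> z s \<in> fst c \<and> transverse c (\<Gamma> z s) = h (transverse c0 (\<Gamma> z 0))"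
      using slide by auto
    ultimately show ?case
    proof eventually_elim
      case (elim z)
      show ?case
      proof
        assume tangent: "tangent_path F (\<Gamma> z) 1"
        \<comment> \<open>Tangency makes the transverse coordinate locally constant on
          \<open>{s..s'}\<close>, which is connected.\<close>
        have "transverse c (\<Gamma> z s) = transverse c (\<Gamma> z s')"
        proof (rule connected_local_const[where A = "{s..s'}" and f = "\<lambda>r. transverse c (\<Gamma> z r)"])
          show "\<forall>r\<in>{s..s'}. \<forall>\<^sub>F r' in at r within {s..s'}. transverse c (\<Gamma> z r) = transverse c (\<Gamma> z r')"
          proof
            fix r assume r: "r \<in> {s..s'}"
            then have "r \<in> {0..1}" using c(2) slide.prems by auto
            then have along: "\<forall>\<^sub>F r' in at r within {0..1}. transverse c (\<Gamma> z r') = transverse c (\<Gamma> z r)"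
              using tangent c(1) elim(1) r unfolding tangent_path_def by blast
            have "at r within {s..s'} \<le> at r within {0..1}"
              using c(2) slide.prems by (intro at_le) auto
            from filter_leD[OF this along] show "\<forall>\<^sub>F r' in at r within {s..s'}. transverse c (\<Gamma> z r) = transverse c (\<Gamma> z r')"
              by eventually_elim simp
          qed
        qed (use slide.hyps(2) in auto)
        then show "\<Gamma> z s' \<in> fst c \<and> transverse c (\<Gamma> z s') = h (transverse c0 (\<Gamma> z 0))"
          using elim tangent slide.hyps(2) by auto
      qed
    qed
  next
    case (change c s h d N \<beta>)
    have "\<forall>\<^sub>F z in nhds y. \<Gamma> z s \<in> N" using change.hyps by (intro near) auto
    moreover have "\<forall>\<^sub>F z in nhds y. tangent_path F (\<Gamma> z) 1 \<longrightarrow>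
        \<Gamma> z s \<in> fst c \<and> transverse c (\<Gamma> z s) = h (transverse c0 (\<Gamma> z 0))"
      using change by auto
    ultimately show ?case
      by eventually_elim (use change.hyps in auto)
  qed
qed

text \<open>The iterates of a fixed point are constant, yet inside a contracted neighbourhood they
  converge to \<open>t\<close>.\<close>

lemma topological_contraction_isolated_fixpoint:
  assumes "topological_contraction h t"
  shows "\<forall>\<^sub>F s in nhds t. h s = s \<longrightarrow> s = t"
proof -
  obtain U where U: "open U" "t \<in> U" "\<And>y. y \<in> U \<Longrightarrow> (\<lambda>n. (h ^^ n) y) \<longlonglongrightarrow> t"
    using assms unfolding topological_contraction_def by (metis UNIV_I open_UNIV)
  have "s = t" if "s \<in> U" "h s = s" for s
  proof -
    have "(h ^^ n) s = s" for n by (induction n) (use that in auto)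
    then show ?thesis using U(3)[OF that(1)] by (simp add: LIMSEQ_const_iff)
  qed
  then show ?thesis using U(1,2) unfolding eventually_nhds by blast
qed

text \<open>Near \<open>t\<close>, a fixed point of \<open>h\<close> is also fixed by the local
  inverse \<open>k\<close>, which is a contraction.\<close>

lemma topological_expansion_isolated_fixpoint:
  assumes "topological_expansion h t"
  shows "\<forall>\<^sub>F s in nhds t. h s = s \<longrightarrow> s = t"
proof -
  obtain k where k: "\<forall>\<^sub>F y in nhds t. k (h y) = y" "topological_contraction k t"
    using assms unfolding topological_expansion_def by blast
  show ?thesis
    using k(1) topological_contraction_isolated_fixpoint[OF k(2)]
    by eventually_elim metis
qed

section \<open>Free orbits\<close>

lemma Cn_on_const:
  assumes "open S" "\<And>x. x \<in> S \<Longrightarrow> g x = c"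
  shows "Cn_on n S g"
  using assms(2)
proof (induction n arbitrary: g c)
  case 0
  then have "continuous_on S g \<longleftrightarrow> continuous_on S (\<lambda>_. c)" by (intro continuous_on_cong) auto
  then show ?case by simp
next
  case (Suc n)
  have der: "(g has_derivative (\<lambda>_. 0)) (at x)" if "x \<in> S" for x
    by (rule has_derivative_transform_within_open[OF has_derivative_const \<open>open S\<close> that])
      (use Suc.prems in simp)
  have "frechet_derivative g (at x) v = 0" if "x \<in> S" for x v
    using frechet_derivative_at[OF der[OF that]] by metis
  then have "Cn_on n S (\<lambda>x. frechet_derivative g (at x) v)" for v
    by (rule Suc.IH)
  then show ?case using der by (auto simp: differentiable_def)
qed

text \<open>In the charts of \<open>orbit_atlas\<close> and \<open>standard_atlas\<close> the orbit
  map and its inverse both read as the identity, so this is all the smoothness that a free orbit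
  requires.\<close>

lemma smooth_on_identity:
  assumes "open S" "\<And>x. x \<in> S \<Longrightarrow> f x = x"
  shows "smooth_on S f"
  unfolding smooth_on_def
proof
  fix n
  have der: "(f has_derivative (\<lambda>h. h)) (at x)" if "x \<in> S" for x
    by (rule has_derivative_transform_within_open[OF has_derivative_ident \<open>open S\<close> that])
      (use assms in simp)
  have "continuous_on S f \<longleftrightarrow> continuous_on S (\<lambda>x. x)" using assms by (intro continuous_on_cong) auto
  then have "continuous_on S f" by simp
  moreover have "frechet_derivative f (at x) v = v" if "x \<in> S" for x v
    using frechet_derivative_at[OF der[OF that]] by metis
  then have "Cn_on m S (\<lambda>x. frechet_derivative f (at x) v)" for m v
    by (rule Cn_on_const[OF \<open>open S\<close>])
  ultimately show "Cn_on n S f"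
    using der by (cases n) (auto simp: differentiable_def)
qed

text \<open>For an injective orbit map, every chart of \<open>orbit_atlas\<close> is a restriction
  of its global inverse \<open>h\<close>. Continuity of \<open>h\<close> is immediate from the
  quotient topology: the preimage of a set under \<open>h\<close>, pulled back along the orbit map,
  is the set itself.\<close>

lemma free_orbit_diffeomorphic:
  fixes \<phi> :: "real^'k \<Rightarrow> 'p \<Rightarrow> 'p"
  assumes "inj (\<lambda>v. \<phi> v x)"
  shows "diffeomorphic (orbit_topology \<phi> x) (orbit_atlas \<phi> x) (euclidean :: (real^'k) topology) standard_atlas"
proof -
  let ?k = "\<lambda>v. \<phi> v x"
  define h where "h = inv ?k"
  have hk: "h (\<phi> v x) = v" for v unfolding h_def using inv_f_f[OF assms] by simp
  have image: "\<phi> v x \<in> ?k ` U \<longleftrightarrow> v \<in> U" for v U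
    using assms by (auto simp: inj_def)
  have inv_U: "inv_into U ?k (\<phi> u x) = u" if "u \<in> U" for u U
    using inv_into_f_f[OF inj_on_subset[OF assms subset_UNIV] that] .
  have std: "chart_inv (UNIV, id) = (id :: real^'k \<Rightarrow> real^'k)"
    by (simp add: chart_inv_def)
  have "smooth_map (orbit_topology \<phi> x) (orbit_atlas \<phi> x) euclidean standard_atlas h"
    unfolding smooth_map_def
  proof (intro conjI ballI)
    show "continuous_map (orbit_topology \<phi> x) euclidean h"
      unfolding continuous_map_def
      by (auto simp: topspace_orbit_topology openin_orbit_topology orbit_def hk)
    fix c d assume "c \<in> orbit_atlas \<phi> x" and d: "d \<in> (standard_atlas :: (real^'k, real^'k) chart set)"
    then obtain U where U: "open U" "c = (?k ` U, inv_into U ?k)" by (auto simp: orbit_atlas_def)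
    have "snd c ` {p \<in> fst c. h p \<in> fst d} = inv_into U ?k ` ?k ` U"
      using d U by (simp add: standard_atlas_def)
    also have "\<dots> = U" by (force simp: inv_U image_image)
    finally have dom: "snd c ` {p \<in> fst c. h p \<in> fst d} = U" .
    have "(snd d \<circ> h \<circ> chart_inv c) u = u" if "u \<in> U" for u
    proof -
      have "inj_on (inv_into U ?k) (?k ` U)" by (intro inj_onI) (auto simp: inv_U)
      then have "inv_into (?k ` U) (inv_into U ?k) u = ?k u"
        using inv_into_f_f[of "inv_into U ?k" "?k ` U" "?k u"] that by (simp add: inv_U)
      then show ?thesis using d by (simp add: U standard_atlas_def chart_inv_def hk)
    qed
    then show "smooth_on (snd c ` {p \<in> fst c. h p \<in> fst d}) (snd d \<circ> h \<circ> chart_inv c)"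
      unfolding dom using U(1) by (intro smooth_on_identity)
  qed
  moreover have "smooth_map euclidean standard_atlas (orbit_topology \<phi> x) (orbit_atlas \<phi> x) ?k"
    unfolding smooth_map_def
  proof (intro conjI ballI)
    show "continuous_map euclidean (orbit_topology \<phi> x) ?k"
      using quotient_map_orbit by (rule quotient_imp_continuous_map)
    fix c d assume c: "c \<in> (standard_atlas :: (real^'k, real^'k) chart set)" and "d \<in> orbit_atlas \<phi> x"
    then obtain U where U: "open U" "d = (?k ` U, inv_into U ?k)" by (auto simp: orbit_atlas_def)
    have dom: "snd c ` {p \<in> fst c. \<phi> p x \<in> fst d} = U"
      using c U image by (simp add: standard_atlas_def)
    have "(snd d \<circ> ?k \<circ> chart_inv c) u = u" if "u \<in> U" for u
      using c that by (simp add: U standard_atlas_def std inv_U)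
    then show "smooth_on (snd c ` {p \<in> fst c. \<phi> p x \<in> fst d}) (snd d \<circ> ?k \<circ> chart_inv c)"
      unfolding dom using U(1) by (intro smooth_on_identity)
  qed
  ultimately show ?thesis
    unfolding diffeomorphic_def
    by (intro exI[of _ h] exI[of _ ?k]) (auto simp: topspace_orbit_topology orbit_def hk)
qed

section \<open>Orbits with nontrivial isotropy\<close>

context riemannian_action
begin

lemma stable_curve_mono:
  assumes "stable_curve E c R S y z" "R \<le> R'" "S \<le> S'"
  shows "stable_curve E c R' S' y z"
proof -
  obtain \<sigma> U u s where "\<sigma> 0 = y" "\<sigma> 1 = z" "U 0 = 0" and
    *: "\<forall>t\<in>{0..1::real}. \<sigma> t \<in> fst c \<and> norm (U t) \<le> R \<and>
          (U has_vector_derivative u t) (at t within {0..1}) \<and>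
          ((\<lambda>t. snd c (\<sigma> t)) has_vector_derivative generator c (\<sigma> t) (u t) + s t) (at t within {0..1}) \<and>
          s t \<in> E c (\<sigma> t) \<and> tnorm c (\<sigma> t) (s t) \<le> S"
    using assms(1) unfolding stable_curve_def by blast
  moreover have "norm (U t) \<le> R'" "tnorm c (\<sigma> t) (s t) \<le> S'" if "t \<in> {0..1}" for t
    using *[THEN bspec, OF that] assms(2,3) by linarith+
  ultimately show ?thesis
    unfolding stable_curve_def by (intro exI[of _ \<sigma>] exI[of _ U] exI[of _ u] exI[of _ s]) blast
qed

text \<open>Irreducibility is used at two points. At \<open>z\<close> it supplies the existence of a
  holonomy, which shows that the loop of \<open>z\<close> stays in a leaf. At \<open>y\<close> it
  supplies the germ \<open>h\<close> with an isolated fixed point. Because the loop of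
  \<open>z\<close> closes up, following the plaques of the loop of \<open>y\<close> yields
  \<open>h (transverse c z) = transverse c z\<close>.\<close>

lemma nearby_fixed_points_in_plaque:
  fixes F :: "('m, 'b::euclidean_space) foliated_chart set"
  assumes F: "foliation_atlas F" and irr: "irreducible_action F \<phi>"
    and v: "v \<noteq> 0" "\<phi> v y = y" and c: "c \<in> F" "y \<in> fst c"
  shows "\<forall>\<^sub>F z in nhds y. \<phi> v z = z \<longrightarrow> z \<in> fst c \<and> transverse c z = transverse c y"
proof -
  define \<Gamma> where "\<Gamma> = (\<lambda>z s. \<phi> (s *\<^sub>R v) z)"
  have \<Gamma>: "continuous_on UNIV (\<lambda>(z, s). \<Gamma> z s)"
    unfolding \<Gamma>_def case_prod_beta by (intro continuous_intros)
  have loop_cont: "continuous_on UNIV (\<Gamma> z)" for z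
    unfolding \<Gamma>_def by (intro continuous_intros)
  have tangent: "tangent_path F (\<Gamma> z) 1" if "\<phi> v z = z" for z
  proof -
    obtain d where d: "d \<in> F" "z \<in> fst d" using F unfolding foliation_atlas_def by blast
    then have "\<exists>h. holonomy F (\<Gamma> z) d d 1 h"
      using irr[unfolded irreducible_action_def, rule_format, of v z d] v(1) that by (auto simp: \<Gamma>_def)
    then obtain h where "holonomy F (\<Gamma> z) d d 1 h" by blast
    then show ?thesis using holonomy_tangent_path[OF F loop_cont] by blast
  qed
  obtain h where h: "holonomy F (\<Gamma> y) c c 1 h"
    "topological_contraction h (transverse c y) \<or> topological_expansion h (transverse c y)"
    using irr[unfolded irreducible_action_def, rule_format, of v y c] v c by (auto simp: \<Gamma>_def)
  have "open (fst c)" and "continuous_on (fst c) (snd c)"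
    using F c(1) unfolding foliation_atlas_def homeomorphism_def by blast+
  then have "((\<lambda>z. snd (snd c z)) \<longlongrightarrow> transverse c y) (nhds y)"
    using c(2) by (intro tendsto_snd continuous_on_open_tendsto_nhds)
  moreover have "\<forall>\<^sub>F s in nhds (transverse c y). h s = s \<longrightarrow> s = transverse c y"
    using h(2) topological_contraction_isolated_fixpoint topological_expansion_isolated_fixpoint by blast
  ultimately have "\<forall>\<^sub>F z in nhds y. h (transverse c z) = transverse c z \<longrightarrow> transverse c z = transverse c y"
    by (auto simp: filterlim_iff)
  moreover have "\<forall>\<^sub>F z in nhds y. tangent_path F (\<Gamma> z) 1 \<longrightarrow>
      \<Gamma> z 1 \<in> fst c \<and> transverse c (\<Gamma> z 1) = h (transverse c (\<Gamma> z 0))"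
    using holonomy_nearby[OF F \<Gamma> h(1)] by simp
  ultimately show ?thesis
    by eventually_elim (use tangent in \<open>auto simp: \<Gamma>_def\<close>)
qed

lemma eventually_not_fixed:
  assumes "\<phi> v y \<noteq> y"
  shows "\<forall>\<^sub>F z in nhds y. \<phi> v z \<noteq> z"
proof -
  obtain U V where UV: "open U" "open V" "\<phi> v y \<in> U" "y \<in> V" "U \<inter> V = {}"
    using separated[OF assms] by blast
  have "((\<lambda>z. \<phi> v z) \<longlongrightarrow> \<phi> v y) (nhds y)"
    by (intro tendsto_act tendsto_const filterlim_ident)
  then have "\<forall>\<^sub>F z in nhds y. \<phi> v z \<in> U" using UV(1,3) by (rule topological_tendstoD)
  moreover have "\<forall>\<^sub>F z in nhds y. z \<in> V" using UV(2,4) by (rule eventually_nhds_in_open)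
  ultimately show ?thesis
    by eventually_elim (use UV(5) in auto)
qed

lemma non_free_orbit_compact:
  fixes F :: "('m, 'b::euclidean_space) foliated_chart set"
  assumes compact: "compact (UNIV :: 'm set)" and lf: "locally_free \<phi>"
    and anosov: "anosov_splitting A G \<phi> a Ess Euu"
    and fol: "tangent_foliation A (weak_stable_field \<phi> Ess) F"
    and irr: "irreducible_action F \<phi>"
    and v: "v \<noteq> 0" "\<phi> v x = x"
  shows "compact_space (orbit_topology \<phi> x)"
proof -
  define Q where "Q = {z. \<phi> v z = z}"
  have F: "foliation_atlas F" using fol by (simp add: tangent_foliation_def)
  have "\<exists>V c R S. open V \<and> y \<in> V \<and> c \<in> A \<and> (\<forall>z\<in>V \<inter> Q. stable_curve Ess c R S y z)" for y
  proof (cases "y \<in> Q")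
    case True
    obtain f where f: "f \<in> F" "y \<in> fst f" using F unfolding foliation_atlas_def by blast
    obtain V c R S where V: "open V" "y \<in> V" "c \<in> A"
      "\<And>z. z \<in> V \<Longrightarrow> z \<in> fst f \<Longrightarrow> transverse f z = transverse f y \<Longrightarrow> stable_curve Ess c R S y z"
      by (fact plaque_stable_curves[OF lf anosov fol f])
    obtain V' where V': "open V'" "y \<in> V'"
      "\<And>z. z \<in> V' \<Longrightarrow> \<phi> v z = z \<Longrightarrow> z \<in> fst f \<and> transverse f z = transverse f y"
      using nearby_fixed_points_in_plaque[OF F irr v(1) _ f] True
      unfolding Q_def eventually_nhds by auto
    have "\<forall>z\<in>(V \<inter> V') \<inter> Q. stable_curve Ess c R S y z"
      using V(4) V'(3) by (auto simp: Q_def)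
    then show ?thesis using V(1-3) V'(1,2) by (meson IntI open_Int)
  next
    \<comment> \<open>A point outside \<open>Q\<close> gets a neighbourhood disjoint from
      \<open>Q\<close>, where the condition is vacuous. The finite subcover can thus be extracted
      from a cover of the whole compact manifold.\<close>
    case False
    obtain c where c: "c \<in> A" "y \<in> fst c" by (rule chart_exists)
    obtain V where "open V" "y \<in> V" "\<And>z. z \<in> V \<Longrightarrow> \<phi> v z \<noteq> z"
      using eventually_not_fixed[of v y] False unfolding Q_def eventually_nhds by auto
    then show ?thesis using c(1) by (intro exI[of _ V] exI[of _ c]) (auto simp: Q_def)
  qed
  then obtain V c R S where V: "\<And>y. open (V y)" "\<And>y. y \<in> V y" "\<And>y. c y \<in> A"
    "\<And>y z. z \<in> V y \<Longrightarrow> z \<in> Q \<Longrightarrow> stable_curve Ess (c y) (R y) (S y) y z"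
    by (metis IntI)
  obtain I where I: "finite I" "UNIV \<subseteq> (\<Union>y\<in>I. V y)"
  proof (rule compactE_image[OF compact, of UNIV V])
    show "open (V y)" for y by (rule V(1))
    show "UNIV \<subseteq> (\<Union>y\<in>UNIV. V y)" using V(2) by blast
  qed
  define R' S' where "R' = Max (insert 0 (R ` I))" and "S' = Max (insert 0 (S ` I))"
  have cover: "\<exists>i\<in>I. stable_curve Ess (c i) R' S' i z" if "z \<in> Q" for z
  proof -
    obtain i where i: "i \<in> I" "z \<in> V i" using I(2) by blast
    have "R i \<le> R'" "S i \<le> S'" using I(1) i(1) by (auto simp: R'_def S'_def)
    then show ?thesis using stable_curve_mono[OF V(4)[OF i(2) that]] i(1) by blast
  qed
  have invariant: "\<phi> u z \<in> Q" if "z \<in> Q" for u z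
    using that act_commute[of v u z] by (simp add: Q_def)
  obtain y' where y': "Q \<subseteq> (\<Union>i\<in>I. (\<lambda>b. \<phi> b (y' i)) ` cball 0 R')"
    using invariant_set_in_finitely_many_orbit_pieces[OF compact anosov invariant I(1) V(3) cover] by blast
  have orbit_Q: "orbit \<phi> x \<subseteq> Q"
    using invariant v(2) by (auto simp: orbit_def Q_def)
  \<comment> \<open>A piece that meets the orbit of \<open>x\<close> has its centre
    \<open>y' i\<close> on it. Writing this centre as \<open>\<phi> (w i) x\<close> lifts the piece
    to a translated ball in the acting group, so the orbit is the image of the compact set
    \<open>B\<close> under the orbit map, which is continuous into the quotient topology.\<close>
  define J where "J = {i\<in>I. y' i \<in> orbit \<phi> x}"
  have "\<exists>w. \<forall>i\<in>J. y' i = \<phi> (w i) x" by (rule bchoice) (auto simp: J_def orbit_def)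
  then obtain w where w: "\<And>i. i \<in> J \<Longrightarrow> y' i = \<phi> (w i) x" by blast
  define B where "B = (\<Union>i\<in>J. (\<lambda>b. b + w i) ` cball 0 R')"
  have "compact B"
    unfolding B_def using I(1)
    by (intro compact_UN compact_continuous_image continuous_intros compact_cball) (auto simp: J_def)
  have "orbit \<phi> x \<subseteq> (\<lambda>u. \<phi> u x) ` B"
  proof
    fix p assume p: "p \<in> orbit \<phi> x"
    then obtain i b where i: "i \<in> I" and b: "b \<in> cball 0 R'" "p = \<phi> b (y' i)"
      using orbit_Q y' by blast
    obtain u where "p = \<phi> u x" using p by (auto simp: orbit_def)
    then have "y' i = \<phi> (- b + u) x" using b(2) by (metis act_add act_zero add.left_inverse)
    then have "i \<in> J" using i by (auto simp: J_def orbit_def)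
    then have "p = \<phi> (b + w i) x" using b(2) w by (simp add: act_add)
    moreover have "b + w i \<in> B" using \<open>i \<in> J\<close> b(1) unfolding B_def by blast
    ultimately show "p \<in> (\<lambda>u. \<phi> u x) ` B" by blast
  qed
  then have "(\<lambda>u. \<phi> u x) ` B = topspace (orbit_topology \<phi> x)"
    by (auto simp: topspace_orbit_topology orbit_def)
  moreover have "compactin (orbit_topology \<phi> x) ((\<lambda>u. \<phi> u x) ` B)"
    using \<open>compact B\<close> quotient_imp_continuous_map[OF quotient_map_orbit]
    by (intro image_compactin[of euclidean]) auto
  ultimately show ?thesis by (simp add: compact_space_def)
qed

end

theorem proposition3:
  fixes A :: "('m::topological_space, 'e::euclidean_space) chart set"
    and G :: "('m, 'e) chart \<Rightarrow> 'm \<Rightarrow> 'e \<Rightarrow> 'e \<Rightarrow> real"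
    and \<phi> :: "real^'k \<Rightarrow> 'm \<Rightarrow> 'm"
    and a :: "real^'k"
    and Ess Euu :: "('m, 'e) plane_field"
    and Fs :: "('m, 'b::euclidean_space) foliated_chart set"
  assumes manifold: "smooth_manifold (euclidean :: 'm topology) A"
    and closed: "compact (UNIV :: 'm set)"
    and connected: "connected (UNIV :: 'm set)"
    and metric: "riemannian_metric A G"
    and action: "C1plus_action A \<phi>"
    and locally_free: "locally_free \<phi>"
    and anosov: "codim_one_splitting A G \<phi> a Ess Euu"
    and foliation: "tangent_foliation A (weak_stable_field \<phi> Ess) Fs"
    and irreducible: "irreducible_action Fs \<phi>"
  shows "\<forall>x. \<not> compact_space (orbit_topology \<phi> x) \<longrightarrow>
           diffeomorphic (orbit_topology \<phi> x) (orbit_atlas \<phi> x)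
             (euclidean :: (real^'k) topology) standard_atlas"
proof (intro allI impI)
  fix x assume noncompact: "\<not> compact_space (orbit_topology \<phi> x)"
  interpret riemannian_action A \<phi> G
    using manifold action metric by unfold_locales
  have "inj (\<lambda>v. \<phi> v x)"
  proof (rule injI)
    fix u v assume "\<phi> u x = \<phi> v x"
    then have "\<phi> (u - v) x = x"
      by (metis act_add act_zero add.left_inverse add.commute uminus_add_conv_diff)
    then show "u = v"
      using non_free_orbit_compact[OF closed locally_free _ foliation irreducible, of a Euu "u - v" x]
        anosov noncompact by (auto simp: codim_one_splitting_def)
  qed
  then show "diffeomorphic (orbit_topology \<phi> x) (orbit_atlas \<phi> x)
      (euclidean :: (real^'k) topology) standard_atlas"
    by (rule free_orbit_diffeomorphic)
qed

end
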